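(* Let $d\ge 0$ be an integer and let $S(2,d)$ be the Schur algebra over $\mathbb{Q}$ (defined in the context). Then $S(2,d)$ is isomorphic with the associative $\mathbb{Q}$-algebra with $1$ generated by $e,f,h$ subject to the relations $$he-eh=2e,\qquad ef-fe=h,\qquad hf-fh=-2f,$$ $$(h+d)(h+d-2)\cdots(h-d+2)(h-d)=0.$$ Moreover, this presented algebra has a $\mathbb{Q}$-basis consisting of all $f^a h^b e^c$ with $a,b,c$ nonnegative integers such that $a+b+c\le d$.
   Context: Let $E$ be a $2$-dimensional $\mathbb{Q}$-vector space with fixed basis $e_1,e_2$, identifying $GL(E)$ with $GL_2(\mathbb{Q})$. The group $GL_2(\mathbb{Q})$ acts diagonally on the tensor power $E^{\otimes d}$; extending linearly gives a representation of the group algebra $\mathbb{Q}GL_2(\mathbb{Q})\to \mathrm{End}(E^{\otimes d})$, and the Schur algebra $S(2,d)$ is its image. Equivalently, $S(2,d)$ is the image of the representation $\rho_d:U(\mathfrak{gl}_2)\to\mathrm{End}(E^{\otimes d})$ of the universal enveloping algebra obtained by differentiating (an element $x\in\mathfrak{gl}_2$ acts as $\sum_{i=1}^d 1\otimes\cdots\otimes x\otimes\cdots\otimes 1$, with $x$ in the $i$-th slot). *)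

theory Defs
  imports Complex_Main
begin

datatype gen = GE | GF | GH

definition npoly :: "(gen list \<Rightarrow> rat) set" where
  "npoly = {p. finite {w. p w \<noteq> 0}}"

definition nc_add :: "(gen list \<Rightarrow> rat) \<Rightarrow> (gen list \<Rightarrow> rat) \<Rightarrow> (gen list \<Rightarrow> rat)" where
  "nc_add p q = (\<lambda>w. p w + q w)"

definition nc_smult :: "rat \<Rightarrow> (gen list \<Rightarrow> rat) \<Rightarrow> (gen list \<Rightarrow> rat)" where
  "nc_smult c p = (\<lambda>w. c * p w)"

definition nc_sub :: "(gen list \<Rightarrow> rat) \<Rightarrow> (gen list \<Rightarrow> rat) \<Rightarrow> (gen list \<Rightarrow> rat)" where
  "nc_sub p q = (\<lambda>w. p w - q w)"

definition nc_mult :: "(gen list \<Rightarrow> rat) \<Rightarrow> (gen list \<Rightarrow> rat) \<Rightarrow> (gen list \<Rightarrow> rat)" where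
  "nc_mult p q = (\<lambda>w. \<Sum>i\<in>{0..length w}. p (take i w) * q (drop i w))"

definition nc_const :: "rat \<Rightarrow> (gen list \<Rightarrow> rat)" where
  "nc_const c = (\<lambda>w. if w = [] then c else 0)"

definition nc_var :: "gen \<Rightarrow> (gen list \<Rightarrow> rat)" where
  "nc_var g = (\<lambda>w. if w = [g] then 1 else 0)"

primrec nc_pow :: "(gen list \<Rightarrow> rat) \<Rightarrow> nat \<Rightarrow> (gen list \<Rightarrow> rat)" where
  "nc_pow p 0 = nc_const 1"
| "nc_pow p (Suc n) = nc_mult p (nc_pow p n)"

definition nc_prod_list :: "(gen list \<Rightarrow> rat) list \<Rightarrow> (gen list \<Rightarrow> rat)" where
  "nc_prod_list xs = foldr nc_mult xs (nc_const 1)"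

abbreviation "ncE \<equiv> nc_var GE"
abbreviation "ncF \<equiv> nc_var GF"
abbreviation "ncH \<equiv> nc_var GH"

inductive_set nc_ideal :: "(gen list \<Rightarrow> rat) set \<Rightarrow> (gen list \<Rightarrow> rat) set"
  for R :: "(gen list \<Rightarrow> rat) set" where
  gen: "r \<in> R \<Longrightarrow> r \<in> nc_ideal R"
| zero: "(\<lambda>_. 0) \<in> nc_ideal R"
| add: "a \<in> nc_ideal R \<Longrightarrow> b \<in> nc_ideal R \<Longrightarrow> nc_add a b \<in> nc_ideal R"
| mult: "a \<in> nc_ideal R \<Longrightarrow> x \<in> npoly \<Longrightarrow> y \<in> npoly \<Longrightarrow> nc_mult x (nc_mult a y) \<in> nc_ideal R"

definition schur_relators :: "nat \<Rightarrow> (gen list \<Rightarrow> rat) set" where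
  "schur_relators d =
    { nc_sub (nc_sub (nc_mult ncH ncE) (nc_mult ncE ncH)) (nc_smult 2 ncE),
      nc_sub (nc_sub (nc_mult ncE ncF) (nc_mult ncF ncE)) ncH,
      nc_add (nc_sub (nc_mult ncH ncF) (nc_mult ncF ncH)) (nc_smult 2 ncF),
      nc_prod_list (map (\<lambda>j. nc_add ncH (nc_const (of_int (int d - 2 * int j)))) [0..<d+1]) }"

definition pres_ideal :: "nat \<Rightarrow> (gen list \<Rightarrow> rat) set" where
  "pres_ideal d = nc_ideal (schur_relators d)"

definition pbw_mon :: "nat \<Rightarrow> nat \<Rightarrow> nat \<Rightarrow> (gen list \<Rightarrow> rat)" where
  "pbw_mon a b c = nc_mult (nc_pow ncF a) (nc_mult (nc_pow ncH b) (nc_pow ncE c))"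

text \<open>Basis of E^{\<otimes>d}: words of length d over {e1,e2} (False = e1, True = e2).
  Endomorphisms are matrices indexed by such words (entries zero elsewhere).\<close>

definition tens_words :: "nat \<Rightarrow> bool list set" where
  "tens_words d = {w. length w = d}"

definition mat_mult :: "nat \<Rightarrow> (bool list \<Rightarrow> bool list \<Rightarrow> rat) \<Rightarrow> (bool list \<Rightarrow> bool list \<Rightarrow> rat)
    \<Rightarrow> (bool list \<Rightarrow> bool list \<Rightarrow> rat)" where
  "mat_mult d M N = (\<lambda>u v. \<Sum>w\<in>tens_words d. M u w * N w v)"

definition mat_one :: "nat \<Rightarrow> (bool list \<Rightarrow> bool list \<Rightarrow> rat)" where
  "mat_one d = (\<lambda>u v. if u = v \<and> length u = d then 1 else 0)"

text \<open>Differentiated action of x in gl_2 (a 2x2 matrix) on E^{\<otimes>d}: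
  sum over slots i of 1 \<otimes> ... \<otimes> x \<otimes> ... \<otimes> 1.\<close>
definition rho :: "nat \<Rightarrow> (bool \<Rightarrow> bool \<Rightarrow> rat) \<Rightarrow> (bool list \<Rightarrow> bool list \<Rightarrow> rat)" where
  "rho d x = (\<lambda>u v. if length u = d \<and> length v = d then
       (\<Sum>i<d. x (u ! i) (v ! i) * (if (\<forall>j<d. j \<noteq> i \<longrightarrow> u ! j = v ! j) then 1 else 0))
     else 0)"

text \<open>S(2,d) = image of U(gl_2) under rho_d = unital subalgebra generated by rho_d(gl_2).\<close>
inductive_set schur_alg :: "nat \<Rightarrow> (bool list \<Rightarrow> bool list \<Rightarrow> rat) set" for d :: nat where
  one: "mat_one d \<in> schur_alg d"
| gen: "rho d x \<in> schur_alg d"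
| add: "M \<in> schur_alg d \<Longrightarrow> N \<in> schur_alg d \<Longrightarrow> (\<lambda>u v. M u v + N u v) \<in> schur_alg d"
| smult: "M \<in> schur_alg d \<Longrightarrow> (\<lambda>u v. c * M u v) \<in> schur_alg d"
| mult: "M \<in> schur_alg d \<Longrightarrow> N \<in> schur_alg d \<Longrightarrow> mat_mult d M N \<in> schur_alg d"

definition free_alg_hom :: "nat \<Rightarrow> ((gen list \<Rightarrow> rat) \<Rightarrow> (bool list \<Rightarrow> bool list \<Rightarrow> rat)) \<Rightarrow> bool" where
  "free_alg_hom d \<phi> \<longleftrightarrow>
     (\<forall>p\<in>npoly. \<forall>q\<in>npoly. \<phi> (nc_add p q) = (\<lambda>u v. \<phi> p u v + \<phi> q u v)) \<and>
     (\<forall>c. \<forall>p\<in>npoly. \<phi> (nc_smult c p) = (\<lambda>u v. c * \<phi> p u v)) \<and>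
     (\<forall>p\<in>npoly. \<forall>q\<in>npoly. \<phi> (nc_mult p q) = mat_mult d (\<phi> p) (\<phi> q)) \<and>
     \<phi> (nc_const 1) = mat_one d"

end

theory Submission
  imports Defs
begin

text \<open>
  Spanning. Filter the free algebra by word length, with the defining ideal in degree zero.
  Commutators with generators do not raise the degree, so the \<open>sl\<^sub>2\<close> relations put every word into
  the form \<open>f ^ a * h ^ b * e ^ c\<close>. The last relation says that \<open>h ^ (d + 1)\<close> has degree at most \<open>d\<close>.
  Applying \<open>ad e\<close> and \<open>ad f\<close> shows the same for all monomials of degree \<open>d + 1\<close>, so the filtration
  stops growing at degree \<open>d\<close>.

  Independence. On tensor space, \<open>f\<close> and \<open>e\<close> act by nonnegative matrices that switch one letter
  \<open>e\<^sub>1\<close> to \<open>e\<^sub>2\<close> or back. In a linear dependency take a pair \<open>(a, k)\<close> of exponents of \<open>f\<close> and \<open>e\<close>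
  with \<open>a + k\<close> maximal. Suitable matrix entries isolate the polynomial in \<open>h\<close> between \<open>f ^ a\<close> and
  \<open>e ^ k\<close> and evaluate it at the \<open>d - a - k + 1\<close> points \<open>d - 2 s\<close>, which is more than its degree.
  So the images of the monomials are independent, and the kernel of the representation is exactly
  the defining ideal.
\<close>

section \<open>The free algebra as a ring type\<close>

typedef fralg = npoly
  by (auto simp: npoly_def intro!: exI[of _ "\<lambda>_. 0"])

setup_lifting type_definition_fralg

section \<open>Finitely supported functions and their convolution product\<close>

lemma nc_mult_support:
  "{w. nc_mult p q w \<noteq> 0} \<subseteq> (\<lambda>(u, v). u @ v) ` ({w. p w \<noteq> 0} \<times> {w. q w \<noteq> 0})"
proof
  fix w assume "w \<in> {w. nc_mult p q w \<noteq> 0}"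
  then obtain i where "p (take i w) * q (drop i w) \<noteq> 0"
    unfolding nc_mult_def by (auto elim: sum.not_neutral_contains_not_neutral)
  then show "w \<in> (\<lambda>(u, v). u @ v) ` ({w. p w \<noteq> 0} \<times> {w. q w \<noteq> 0})"
    by (auto intro!: image_eqI[of _ _ "(take i w, drop i w)"])
qed

lemma nc_mult_npoly: "p \<in> npoly \<Longrightarrow> q \<in> npoly \<Longrightarrow> nc_mult p q \<in> npoly"
  unfolding npoly_def mem_Collect_eq
  by (rule finite_subset[OF nc_mult_support]) auto

lemma nc_add_npoly: "p \<in> npoly \<Longrightarrow> q \<in> npoly \<Longrightarrow> nc_add p q \<in> npoly"
  unfolding npoly_def mem_Collect_eq nc_add_def
  by (rule finite_subset[of _ "{w. p w \<noteq> 0} \<union> {w. q w \<noteq> 0}"]) auto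

lemma nc_sub_npoly: "p \<in> npoly \<Longrightarrow> q \<in> npoly \<Longrightarrow> nc_sub p q \<in> npoly"
  unfolding npoly_def mem_Collect_eq nc_sub_def
  by (rule finite_subset[of _ "{w. p w \<noteq> 0} \<union> {w. q w \<noteq> 0}"]) auto

lemma nc_smult_npoly: "p \<in> npoly \<Longrightarrow> nc_smult c p \<in> npoly"
  unfolding npoly_def mem_Collect_eq nc_smult_def
  by (rule finite_subset[of _ "{w. p w \<noteq> 0}"]) auto

lemma zero_npoly: "(\<lambda>_. 0) \<in> npoly"
  by (simp add: npoly_def)

lemma nc_const_npoly: "nc_const c \<in> npoly"
  unfolding npoly_def mem_Collect_eq nc_const_def
  by (rule finite_subset[of _ "{[]}"]) auto

lemma nc_var_npoly: "nc_var g \<in> npoly"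
  unfolding npoly_def mem_Collect_eq nc_var_def
  by (rule finite_subset[of _ "{[g]}"]) auto

lemma nc_mult_assoc: "nc_mult (nc_mult p q) r = nc_mult p (nc_mult q r)"
proof
  fix w :: "gen list"
  let ?n = "length w"
  have "nc_mult (nc_mult p q) r w =
      (\<Sum>j\<le>?n. \<Sum>i\<le>j. p (take i w) * q (take (j - i) (drop i w)) * r (drop j w))"
    by (auto simp: nc_mult_def sum_distrib_right atLeast0AtMost drop_take min_def intro!: sum.cong)
  also have "\<dots> = (\<Sum>(j, i) \<in> Sigma {..?n} (\<lambda>j. {..j}). p (take i w) * q (take (j - i) (drop i w)) * r (drop j w))"
    by (subst sum.Sigma) auto
  \<comment> \<open>Both sides sum over the cuts of \<open>w\<close> into three factors. The cut
    points \<open>i \<le> j\<close> are replaced by \<open>i\<close> and the length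
    \<open>k = j - i\<close> of the middle factor.\<close>
  also have "\<dots> = (\<Sum>(i, k) \<in> Sigma {..?n} (\<lambda>i. {..?n - i}). p (take i w) * q (take k (drop i w)) * r (drop (k + i) w))"
    by (rule sum.reindex_bij_witness[of _ "\<lambda>(i, k). (k + i, i)" "\<lambda>(j, i). (i, j - i)"]) auto
  also have "\<dots> = (\<Sum>i\<le>?n. \<Sum>k\<le>?n - i. p (take i w) * q (take k (drop i w)) * r (drop (k + i) w))"
    by (subst sum.Sigma) auto
  also have "\<dots> = nc_mult p (nc_mult q r) w"
    by (auto simp: nc_mult_def sum_distrib_left atLeast0AtMost mult.assoc intro!: sum.cong)
  finally show "nc_mult (nc_mult p q) r w = nc_mult p (nc_mult q r) w" .
qed

lemma nc_mult_const_left: "nc_mult (nc_const c) p = nc_smult c p"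
proof
  fix w :: "gen list"
  have "nc_mult (nc_const c) p w = (\<Sum>i\<in>{0..length w}. if i = 0 then c * p w else 0)"
    unfolding nc_mult_def by (rule sum.cong) (auto simp: nc_const_def)
  then show "nc_mult (nc_const c) p w = nc_smult c p w"
    by (simp add: nc_smult_def)
qed

lemma nc_mult_const_right: "nc_mult p (nc_const c) = nc_smult c p"
proof
  fix w :: "gen list"
  have "nc_mult p (nc_const c) w = (\<Sum>i\<in>{0..length w}. if i = length w then c * p w else 0)"
    unfolding nc_mult_def by (rule sum.cong) (auto simp: nc_const_def)
  then show "nc_mult p (nc_const c) w = nc_smult c p w"
    by (simp add: nc_smult_def)
qed

instantiation fralg :: ring_1
begin

lift_definition zero_fralg :: fralg is "\<lambda>_. 0" by (rule zero_npoly)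
lift_definition one_fralg :: fralg is "nc_const 1" by (rule nc_const_npoly)
lift_definition plus_fralg :: "fralg \<Rightarrow> fralg \<Rightarrow> fralg" is nc_add by (rule nc_add_npoly)
lift_definition minus_fralg :: "fralg \<Rightarrow> fralg \<Rightarrow> fralg" is nc_sub by (rule nc_sub_npoly)
lift_definition uminus_fralg :: "fralg \<Rightarrow> fralg" is "nc_smult (-1)" by (rule nc_smult_npoly)
lift_definition times_fralg :: "fralg \<Rightarrow> fralg \<Rightarrow> fralg" is nc_mult by (rule nc_mult_npoly)

instance
proof
  fix a b c :: fralg
  show "a + b + c = a + (b + c)" by transfer (simp add: nc_add_def add.assoc)
  show "a + b = b + a" by transfer (simp add: nc_add_def add.commute)
  show "0 + a = a" by transfer (simp add: nc_add_def)
  show "- a + a = 0" by transfer (simp add: nc_add_def nc_smult_def)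
  show "a - b = a + - b" by transfer (simp add: nc_add_def nc_smult_def nc_sub_def)
  show "a * b * c = a * (b * c)" by transfer (rule nc_mult_assoc)
  show "1 * a = a" by transfer (simp add: nc_mult_const_left nc_smult_def)
  show "a * 1 = a" by transfer (simp add: nc_mult_const_right nc_smult_def)
  show "(a + b) * c = a * c + b * c"
    by transfer (simp add: nc_mult_def nc_add_def distrib_right sum.distrib)
  show "a * (b + c) = a * b + a * c"
    by transfer (simp add: nc_mult_def nc_add_def distrib_left sum.distrib)
  show "(0::fralg) \<noteq> 1"
    by transfer (metis nc_const_def zero_neq_one)
qed

end

lift_definition fconst :: "rat \<Rightarrow> fralg" is nc_const by (rule nc_const_npoly)
lift_definition fvar :: "gen \<Rightarrow> fralg" is nc_var by (rule nc_var_npoly)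

lemma fconst_add: "fconst (a + b) = fconst a + fconst b"
  by transfer (auto simp: nc_const_def nc_add_def)

lemma fconst_mult: "fconst (a * b) = fconst a * fconst b"
  by transfer (simp only: nc_mult_const_left, auto simp: nc_smult_def nc_const_def)

lemma fconst_1: "fconst 1 = 1"
  by transfer (rule refl)

lemma fconst_commute: "fconst c * x = x * fconst c"
  by transfer (simp add: nc_mult_const_left nc_mult_const_right)

lemma fconst_scale: "Rep_fralg (fconst c * x) = nc_smult c (Rep_fralg x)"
  by transfer (rule nc_mult_const_left)

section \<open>The degree filtration\<close>

abbreviation simplex :: "nat \<Rightarrow> (nat \<times> nat \<times> nat) set" where
  "simplex d \<equiv> {(a, b, k). a + b + k \<le> d}"

lemma finite_simplex: "finite (simplex d)"
proof -
  have "simplex d \<subseteq> {..d} \<times> {..d} \<times> {..d}" by auto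
  then show ?thesis by (rule finite_subset) simp
qed

text \<open>The spanning half works modulo a two-sided ideal in any ring with central scalars, so no
  quotient ring has to be formed. The polynomial relation in \<open>h\<close> comes in later, as a
  hypothesis of \<open>pbw_span\<close>.\<close>

locale sl2_ideal =
  fixes I :: "'r::ring_1 set" and sc :: "rat \<Rightarrow> 'r" and e f h :: 'r
  assumes sc_add: "sc (a + b) = sc a + sc b"
    and sc_mult: "sc (a * b) = sc a * sc b"
    and sc_1: "sc 1 = 1"
    and sc_commute: "sc a * x = x * sc a"
    and ideal_0: "0 \<in> I"
    and ideal_add: "x \<in> I \<Longrightarrow> y \<in> I \<Longrightarrow> x + y \<in> I"
    and ideal_left: "x \<in> I \<Longrightarrow> y * x \<in> I"
    and ideal_right: "x \<in> I \<Longrightarrow> x * y \<in> I"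
    and rel_he: "h * e - e * h - sc 2 * e \<in> I"
    and rel_ef: "e * f - f * e - h \<in> I"
    and rel_hf: "h * f - f * h + sc 2 * f \<in> I"
begin

lemma sc_0: "sc 0 = 0"
  using sc_add[of 0 0] by simp

lemma sc_minus: "sc (- a) = - sc a"
  using sc_add[of a "- a"] by (simp add: sc_0 add_eq_0_iff)

text \<open>Degree filtration by word length; the ideal sits in degree zero, so that statements about
  \<open>filt\<close> are statements about the quotient by \<open>I\<close>.\<close>

inductive in_filt :: "nat \<Rightarrow> 'r \<Rightarrow> bool" where
  "x \<in> I \<Longrightarrow> in_filt n x"
| "in_filt n (sc a)"
| "in_filt n x \<Longrightarrow> in_filt n y \<Longrightarrow> in_filt n (x + y)"
| "in_filt n x \<Longrightarrow> g \<in> {e, f, h} \<Longrightarrow> in_filt (Suc n) (g * x)"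

definition filt :: "nat \<Rightarrow> 'r set" where
  "filt n = Collect (in_filt n)"

lemma in_filt_iff: "in_filt n x \<longleftrightarrow> x \<in> filt n"
  by (simp add: filt_def)

lemmas filt_intros = in_filt.intros[unfolded in_filt_iff]
lemmas filt_ideal = filt_intros(1) and filt_scalar = filt_intros(2)
  and filt_add = filt_intros(3) and filt_step = filt_intros(4)
lemmas filt_induct = in_filt.induct[unfolded in_filt_iff, consumes 1, case_names ideal scalar add step]

text \<open>Only left multiplication by generators is built into the filtration. Reassociating
  reduces the general product to that case; scalars are pulled through the generators of
  \<open>y\<close> by a second induction.\<close>

lemma filt_mult: "x \<in> filt m \<Longrightarrow> y \<in> filt n \<Longrightarrow> x * y \<in> filt (m + n)"
proof (induction arbitrary: y n rule: filt_induct)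
  case (ideal x m)
  then show ?case by (intro filt_ideal ideal_right)
next
  case (scalar m a)
  from scalar show ?case
  proof (induction rule: filt_induct)
    case (ideal x n)
    then show ?case by (intro filt_ideal ideal_left)
  next
    case (scalar n b)
    then show ?case by (metis filt_scalar sc_mult)
  next
    case (add n x y)
    then show ?case by (simp add: distrib_left filt_add)
  next
    case (step n x g)
    have "sc a * (g * x) = g * (sc a * x)"
      by (metis mult.assoc sc_commute)
    with step show ?case
      by (metis add_Suc_right filt_step)
  qed
next
  case (add m x x')
  then show ?case by (simp add: distrib_right filt_add)
next
  case (step m x g)
  then show ?case by (simp add: mult.assoc filt_step)
qed

lemma filt_Suc: "x \<in> filt n \<Longrightarrow> x \<in> filt (Suc n)"
  by (induction rule: filt_induct) (auto intro: filt_intros)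

lemma filt_mono: "x \<in> filt m \<Longrightarrow> m \<le> n \<Longrightarrow> x \<in> filt n"
  by (induction n) (auto simp: le_Suc_eq intro: filt_Suc)

lemma filt_scale: "x \<in> filt n \<Longrightarrow> sc a * x \<in> filt n"
  using filt_mult[OF filt_scalar[of a 0]] by simp

lemma filt_minus: "x \<in> filt n \<Longrightarrow> - x \<in> filt n"
  using filt_scale[of x n "-1"] by (simp add: sc_minus sc_1)

lemma filt_diff: "x \<in> filt n \<Longrightarrow> y \<in> filt n \<Longrightarrow> x - y \<in> filt n"
  using filt_add[of x n "- y"] filt_minus by simp

lemma filt_0: "0 \<in> filt n"
  using ideal_0 by (rule filt_ideal)

lemma filt_1: "1 \<in> filt n"
  using filt_scalar[of 1] by (simp add: sc_1)

lemma filt_gen: "g \<in> {e, f, h} \<Longrightarrow> g \<in> filt (Suc n)"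
  using filt_step[OF filt_1, of g n] by simp

lemma filt_power: "g \<in> {e, f, h} \<Longrightarrow> g ^ n \<in> filt n"
  by (induction n) (auto intro: filt_1 filt_step)

lemma filt_unscale: "sc a * x \<in> filt n \<Longrightarrow> a \<noteq> 0 \<Longrightarrow> x \<in> filt n"
  using filt_scale[of "sc a * x" n "inverse a"]
  by (simp add: mult.assoc[symmetric] sc_mult[symmetric] sc_1)

lemma filt_sum: "(\<And>i. i \<in> A \<Longrightarrow> x i \<in> filt n) \<Longrightarrow> sum x A \<in> filt n"
  by (induction A rule: infinite_finite_induct) (auto intro: filt_0 filt_add)

section \<open>Commutators with generators\<close>

lemma comm_he: "h * e - e * h - sc 2 * e \<in> filt n"
  and comm_eh: "e * h - h * e - sc (- 2) * e \<in> filt n"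
  and comm_ef: "e * f - f * e - h \<in> filt n"
  and comm_fe: "f * e - e * f - sc (- 1) * h \<in> filt n"
  and comm_hf: "h * f - f * h - sc (- 2) * f \<in> filt n"
  and comm_fh: "f * h - h * f - sc 2 * f \<in> filt n"
  using filt_ideal[OF rel_he, of n] filt_ideal[OF rel_ef, of n] filt_ideal[OF rel_hf, of n]
    filt_minus[OF filt_ideal[OF rel_he, of n]] filt_minus[OF filt_ideal[OF rel_ef, of n]]
    filt_minus[OF filt_ideal[OF rel_hf, of n]]
  by (simp_all add: sc_minus sc_1 algebra_simps)

lemma comm_gen:
  assumes "g \<in> {e, f, h}" "g' \<in> {e, f, h}"
  shows "g * g' - g' * g \<in> filt 1"
proof -
  have *: "x - y - sc a * k \<in> filt 0 \<Longrightarrow> k \<in> {e, f, h} \<Longrightarrow> x - y \<in> filt 1" for x y a k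
    using filt_add[OF filt_Suc filt_scale[OF filt_gen, of k a 0]] by fastforce
  have "e * f - f * e \<in> filt 1"
    using *[of "e * f" "f * e" 1 h] comm_ef by (simp add: sc_1)
  then show ?thesis
    using assms *[OF comm_he] *[OF comm_eh] *[OF comm_fe] *[OF comm_hf] *[OF comm_fh]
    by (auto simp: filt_0)
qed

text \<open>\<open>ad g\<close> is a derivation, and on a generator its value has degree at most 1
  by \<open>comm_gen\<close>. So the commutator stays in degree \<open>n\<close>, where the two
  products alone would only give \<open>n + 1\<close>.\<close>

lemma filt_comm_gen:
  assumes "g \<in> {e, f, h}" "x \<in> filt n"
  shows "g * x - x * g \<in> filt n"
  using assms(2)
proof (induction rule: filt_induct)
  case (ideal x n)
  have "g * x + - 1 * (x * g) \<in> I"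
    using ideal by (intro ideal_add ideal_left ideal_right)
  then show ?case by (auto intro: filt_ideal)
next
  case (scalar n a)
  then show ?case by (simp add: sc_commute filt_0)
next
  case (add n x y)
  have "g * (x + y) - (x + y) * g = (g * x - x * g) + (g * y - y * g)"
    by (simp add: algebra_simps)
  with add show ?case by (metis filt_add)
next
  case (step n x k)
  have "g * (k * x) - (k * x) * g = (g * k - k * g) * x + k * (g * x - x * g)"
    by (simp add: algebra_simps)
  moreover have "(g * k - k * g) * x \<in> filt (Suc n)"
    using filt_mult[OF comm_gen[OF assms(1) step(2)] step(1)] by simp
  ultimately show ?case
    using step by (metis filt_add filt_step)
qed

text \<open>By the derivation rule, \<open>ad g\<close> of \<open>x ^ Suc n\<close> has
  \<open>Suc n\<close> terms, each with one factor \<open>x\<close> replaced by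
  \<open>sc k * y\<close>. Moving that \<open>y\<close> to the left end changes a term only in lower
  degree, so the leading terms add up.\<close>

lemma ad_power:
  assumes "g \<in> {e, f, h}" "x \<in> {e, f, h}" "y \<in> {e, f, h}"
    and rel: "g * x - x * g - sc k * y \<in> filt 0"
  shows "g * x ^ Suc n - x ^ Suc n * g - sc (k * of_nat (Suc n)) * (y * x ^ n) \<in> filt n"
proof (induction n)
  case 0
  then show ?case using rel by simp
next
  case (Suc n)
  let ?k = "sc (k * of_nat (Suc n))"
  have "sc (k * of_nat (Suc (Suc n))) = sc k + ?k"
    by (simp flip: sc_add add: algebra_simps)
  moreover have "?k * (x * (y * x ^ n)) = x * (?k * (y * x ^ n))"
    by (metis mult.assoc sc_commute)
  ultimately have "g * x ^ Suc (Suc n) - x ^ Suc (Suc n) * g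
       - sc (k * of_nat (Suc (Suc n))) * (y * x ^ Suc n)
     = (g * x - x * g - sc k * y) * x ^ Suc n
       + x * (g * x ^ Suc n - x ^ Suc n * g - ?k * (y * x ^ n))
       + ?k * ((x * y - y * x) * x ^ n)"
    by (simp add: algebra_simps)
  moreover have "(g * x - x * g - sc k * y) * x ^ Suc n \<in> filt (Suc n)"
    using filt_mult[OF rel filt_power[OF assms(2), of "Suc n"]] by simp
  moreover have "x * (g * x ^ Suc n - x ^ Suc n * g - ?k * (y * x ^ n)) \<in> filt (Suc n)"
    using Suc assms(2) by (rule filt_step)
  moreover have "?k * ((x * y - y * x) * x ^ n) \<in> filt (Suc n)"
    using filt_mult[OF comm_gen[OF assms(2,3)] filt_power[OF assms(2), of n]]
    by (intro filt_scale) simp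
  ultimately show ?case by (simp only: filt_add)
qed

section \<open>Spanning by ordered monomials\<close>

definition mon :: "nat \<Rightarrow> nat \<Rightarrow> nat \<Rightarrow> 'r" where
  "mon a b c = f ^ a * h ^ b * e ^ c"

lemma filt_mon: "a + b + c \<le> n \<Longrightarrow> mon a b c \<in> filt n"
  unfolding mon_def
  by (rule filt_mono[of _ "a + b + c"]) (auto intro!: filt_mult filt_power)

text \<open>Generating the span by sums keeps it open to induction over its elements;
  \<open>pbw_coeffs\<close> recovers a coefficient function at the end.\<close>

inductive_set pbw :: "nat \<Rightarrow> 'r set" for n where
  ideal: "x \<in> I \<Longrightarrow> x \<in> pbw n"
| scale_mon: "a + b + c \<le> n \<Longrightarrow> sc k * mon a b c \<in> pbw n"
| add: "x \<in> pbw n \<Longrightarrow> y \<in> pbw n \<Longrightarrow> x + y \<in> pbw n"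

lemma pbw_mono: "x \<in> pbw m \<Longrightarrow> m \<le> n \<Longrightarrow> x \<in> pbw n"
  by (induction rule: pbw.induct) (auto intro: pbw.intros)

lemma pbw_scale: "x \<in> pbw n \<Longrightarrow> sc k * x \<in> pbw n"
  by (induction rule: pbw.induct)
    (auto simp: distrib_left mult.assoc[symmetric] sc_mult[symmetric] intro: pbw.intros ideal_left)

lemma pbw_mult_e: "x \<in> pbw n \<Longrightarrow> x * e ^ c \<in> pbw (n + c)"
proof (induction rule: pbw.induct)
  case (scale_mon a b c' k)
  then show ?case
    using pbw.scale_mon[of a b "c' + c" "n + c" k] by (simp add: mon_def power_add mult.assoc)
qed (auto simp: distrib_right intro: pbw.intros ideal_right)

lemma pbw_f: "x \<in> pbw n \<Longrightarrow> f * x \<in> pbw (Suc n)"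
proof (induction rule: pbw.induct)
  case (scale_mon a b c k)
  have "f * (sc k * mon a b c) = sc k * mon (Suc a) b c"
    by (simp add: mon_def) (metis mult.assoc sc_commute)
  with scale_mon show ?case
    using pbw.scale_mon[of "Suc a" b c "Suc n" k] by simp
qed (auto simp: distrib_left intro: pbw.intros ideal_left)

text \<open>Strong induction on the degree around an induction on the element. Left multiplication
  by \<open>f\<close> keeps monomials ordered. A factor \<open>h\<close> or \<open>e\<close> has to
  pass \<open>f ^ a * h ^ b\<close>; the resulting commutator has degree at most
  \<open>a + b\<close>, so the outer hypothesis puts it in order, and multiplying by
  \<open>e ^ c\<close> on the right preserves that order.\<close>

lemma filt_subset_pbw: "filt n \<subseteq> pbw n"
proof (induction n rule: less_induct)
  case (less n)
  show ?case
  proof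
    fix x assume "x \<in> filt n"
    from this less show "x \<in> pbw n"
    proof (induction rule: filt_induct)
      case (ideal x n)
      then show ?case by (auto intro: pbw.ideal)
    next
      case (scalar n a)
      then show ?case
        using pbw.scale_mon[of 0 0 0 n a] by (simp add: mon_def)
    next
      case (add n x y)
      then show ?case by (auto intro: pbw.add)
    next
      case (step n x g)
      have IH: "x \<in> filt m \<Longrightarrow> x \<in> pbw m" if "m \<le> n" for m x
        using step.prems[of m] that by auto
      have g_mon: "g * mon a b c \<in> pbw (Suc n)" if abc: "a + b + c \<le> n" "g \<in> {e, h}" for a b c
      proof -
        let ?x = "f ^ a * h ^ b"
        have eq: "g * mon a b c = ?x * g * e ^ c + (g * ?x - ?x * g) * e ^ c"
          by (simp add: mon_def algebra_simps)
        have "?x \<in> filt (a + b)"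
          by (auto intro!: filt_mult filt_power)
        then have "g * ?x - ?x * g \<in> filt (a + b)"
          using that by (intro filt_comm_gen) auto
        then have "(g * ?x - ?x * g) * e ^ c \<in> pbw (Suc n)"
          using abc IH[of "a + b" "g * ?x - ?x * g"] pbw_mult_e pbw_mono[of _ "a + b + c" "Suc n"]
          by simp
        moreover have "?x * e * e ^ c = mon a b (Suc c)" "?x * h * e ^ c = mon a (Suc b) c"
          by (simp_all add: mon_def mult.assoc power_Suc2[of h] del: power_Suc) simp
        then have "?x * g * e ^ c \<in> pbw (Suc n)"
          using abc pbw.scale_mon[of a b "Suc c" "Suc n" 1] pbw.scale_mon[of a "Suc b" c "Suc n" 1]
          by (auto simp: sc_1)
        ultimately show ?thesis
          unfolding eq by (intro pbw.add)
      qed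
      have "x \<in> pbw n" using step IH by simp
      then show ?case
      proof (cases "g = f")
        case True
        then show ?thesis using \<open>x \<in> pbw n\<close> by (auto intro: pbw_f)
      next
        case False
        from \<open>x \<in> pbw n\<close> show ?thesis
        proof (induction rule: pbw.induct)
          case (scale_mon a b c k)
          have "g * (sc k * mon a b c) = sc k * (g * mon a b c)"
            by (metis mult.assoc sc_commute)
          then show ?case
            using scale_mon g_mon step(2) False by (auto intro: pbw_scale)
        qed (auto simp: distrib_left intro: pbw.intros ideal_left)
      qed
    qed
  qed
qed

lemma pbw_coeffs:
  assumes "x \<in> pbw n"
  shows "\<exists>k. x - (\<Sum>(a, b, c)\<in>simplex n. sc (k (a, b, c)) * mon a b c) \<in> I"
proof -
  let ?T = "simplex n"
  show ?thesis
    using assms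
  proof (induction rule: pbw.induct)
    case (ideal x)
    then show ?case by (intro exI[of _ "\<lambda>_. 0"]) (simp add: sc_0 case_prod_beta)
  next
    case (scale_mon a b c k)
    have "(\<Sum>(a', b', c')\<in>?T. sc (if (a', b', c') = (a, b, c) then k else 0) * mon a' b' c')
        = (\<Sum>t\<in>?T. if t = (a, b, c) then sc k * mon a b c else 0)"
      by (rule sum.cong) (auto simp: sc_0 split: if_splits)
    also have "\<dots> = sc k * mon a b c"
      using scale_mon finite_simplex by simp
    finally show ?case
      by (intro exI[of _ "\<lambda>t. if t = (a, b, c) then k else 0"]) (simp add: ideal_0)
  next
    case (add x y)
    then obtain k l where
      "x - (\<Sum>(a, b, c)\<in>?T. sc (k (a, b, c)) * mon a b c) \<in> I"
      "y - (\<Sum>(a, b, c)\<in>?T. sc (l (a, b, c)) * mon a b c) \<in> I" by blast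
    from ideal_add[OF this] have "x + y - ((\<Sum>(a, b, c)\<in>?T. sc (k (a, b, c)) * mon a b c)
        + (\<Sum>(a, b, c)\<in>?T. sc (l (a, b, c)) * mon a b c)) \<in> I"
      by (simp add: algebra_simps)
    moreover have "(\<Sum>(a, b, c)\<in>?T. sc (k (a, b, c)) * mon a b c)
        + (\<Sum>(a, b, c)\<in>?T. sc (l (a, b, c)) * mon a b c)
        = (\<Sum>(a, b, c)\<in>?T. sc (k (a, b, c) + l (a, b, c)) * mon a b c)"
      unfolding sum.distrib[symmetric] by (rule sum.cong) (auto simp: sc_add distrib_right)
    ultimately show ?case
      by (intro exI[of _ "\<lambda>t. k t + l t"]) simp
  qed
qed

section \<open>Collapse of the filtration above degree \<open>d\<close>\<close>

lemma filt_prod_linear: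
  "foldr (\<lambda>c y. (h + sc c) * y) cs 1 - h ^ length cs \<in> filt (length cs - 1)
    \<and> foldr (\<lambda>c y. (h + sc c) * y) cs 1 \<in> filt (length cs)"
proof (induction cs)
  case Nil
  then show ?case by (simp add: filt_0 filt_1)
next
  case (Cons c cs)
  let ?p = "foldr (\<lambda>c y. (h + sc c) * y) cs 1" and ?n = "length cs"
  have p: "?p \<in> filt ?n" and q: "?p - h ^ ?n \<in> filt (?n - 1)"
    using Cons by auto
  \<comment> \<open>For empty \<open>cs\<close> the bound \<open>?n - 1\<close> truncates and
    \<open>Suc (?n - 1)\<close> is not \<open>?n\<close>; the difference \<open>?p - h ^ ?n\<close>
    is 0 in that case.\<close>
  have "h * (?p - h ^ ?n) \<in> filt ?n"
    using filt_step[OF q, of h] by (cases cs) (simp_all add: filt_0)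
  then have "h * (?p - h ^ ?n) + sc c * ?p \<in> filt ?n"
    using p by (intro filt_add filt_scale)
  moreover have "h * (?p - h ^ ?n) + sc c * ?p = (h + sc c) * ?p - h ^ Suc ?n"
    by (simp add: algebra_simps)
  moreover have "(h + sc c) * ?p \<in> filt (Suc ?n)"
    using filt_mult[of "h + sc c" 1 ?p ?n] p by (auto intro: filt_add filt_gen filt_scalar)
  ultimately show ?case by simp
qed

lemma filt_cancel: "x - y \<in> filt n \<Longrightarrow> x \<in> filt n \<Longrightarrow> y \<in> filt n"
  using filt_diff[of x n "x - y"] by simp

text \<open>Modulo lower filtration degree, \<open>ad e\<close> and then \<open>ad f\<close> carry \<open>h ^ Suc n\<close> to every
  monomial of degree \<open>Suc n\<close>: up to lower terms, \<open>ad e\<close> maps \<open>h ^ Suc b * e ^ c\<close> to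
  a multiple of \<open>h ^ b * e ^ Suc c\<close>, and \<open>ad f\<close> maps \<open>mon a (Suc b) c\<close> to a combination of
  \<open>mon (Suc a) b c\<close> and \<open>mon a (Suc (Suc b)) (c - 1)\<close>.\<close>

lemma top_he:
  assumes "h ^ Suc n \<in> filt n" "b + c = Suc n"
  shows "h ^ b * e ^ c \<in> filt n"
  using assms(2)
proof (induction c arbitrary: b)
  case 0
  then show ?case using assms(1) by simp
next
  case (Suc c)
  let ?x = "h ^ Suc b * e ^ c" and ?k = "- 2 * of_nat (Suc b) :: rat"
  have bc: "n = b + c" using Suc.prems by simp
  have x: "?x \<in> filt n" using Suc.IH[of "Suc b"] Suc.prems by simp
  have "(e * h ^ Suc b - h ^ Suc b * e - sc ?k * (e * h ^ b)) * e ^ c \<in> filt n"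
    unfolding bc by (intro filt_mult filt_power ad_power comm_eh) auto
  moreover have "sc ?k * ((e * h ^ b - h ^ b * e) * e ^ c) \<in> filt n"
    unfolding bc by (intro filt_scale filt_mult filt_comm_gen filt_power) auto
  ultimately have "(e * h ^ Suc b - h ^ Suc b * e - sc ?k * (e * h ^ b)) * e ^ c
      + sc ?k * ((e * h ^ b - h ^ b * e) * e ^ c) \<in> filt n"
    by (rule filt_add)
  also have "(e * h ^ Suc b - h ^ Suc b * e - sc ?k * (e * h ^ b)) * e ^ c
      + sc ?k * ((e * h ^ b - h ^ b * e) * e ^ c)
      = (e * ?x - ?x * e) - sc ?k * (h ^ b * e ^ Suc c)"
    by (simp add: algebra_simps power_commutes)
  \<comment> \<open>The element \<open>?x\<close> has formal degree \<open>Suc n\<close> but lies in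
    \<open>filt n\<close> by induction, and so does its commutator with \<open>e\<close>. What
    remains is the leading term of that commutator, with a nonzero rational coefficient.\<close>
  finally have "sc ?k * (h ^ b * e ^ Suc c) \<in> filt n"
    by (rule filt_cancel) (use x filt_comm_gen[of e ?x n] in auto)
  then show ?case
    by (rule filt_unscale) simp
qed

lemma top_mon:
  assumes "h ^ Suc n \<in> filt n" "a + b + c = Suc n"
  shows "mon a b c \<in> filt n"
  using assms(2)
proof (induction a arbitrary: b c)
  case 0
  then show ?case using top_he[OF assms(1)] by (simp add: mon_def)
next
  case (Suc a)
  let ?x = "mon a (Suc b) c" and ?k = "2 * of_nat (Suc b) :: rat"
  have n: "n = a + b + c" using Suc.prems by simp
  have x: "?x \<in> filt n" using Suc by simp
  have 1: "f ^ a * (f * h ^ Suc b - h ^ Suc b * f - sc ?k * (f * h ^ b)) * e ^ c \<in> filt n"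
    unfolding n by (intro filt_mult filt_power ad_power comm_fh) auto
  \<comment> \<open>Passing \<open>f\<close> through \<open>e ^ c\<close> produces a multiple of
    \<open>h * e ^ (c - 1)\<close>, hence of \<open>mon a (b + 2) (c - 1)\<close>. This again has
    degree \<open>Suc n\<close>, and its smaller exponent of \<open>f\<close> puts it under the
    induction hypothesis.\<close>
  have 2: "f ^ a * h ^ Suc b * (f * e ^ c - e ^ c * f) \<in> filt n"
  proof (cases c)
    case 0
    then show ?thesis by (simp add: filt_0)
  next
    case (Suc c')
    let ?l = "- 1 * of_nat (Suc c') :: rat"
    have "f * e ^ Suc c' - e ^ Suc c' * f - sc ?l * (h * e ^ c') \<in> filt c'"
      by (intro ad_power comm_fe) auto
    from filt_mult[OF filt_mult[OF filt_power[of f a] filt_power[of h "Suc b"]] this]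
    have "f ^ a * h ^ Suc b * (f * e ^ c - e ^ c * f - sc ?l * (h * e ^ c')) \<in> filt n"
      using Suc n by simp
    moreover have "mon a (Suc (Suc b)) c' \<in> filt n"
      using Suc.IH n Suc by simp
    then have "sc ?l * mon a (Suc (Suc b)) c' \<in> filt n"
      by (rule filt_scale)
    ultimately have "f ^ a * h ^ Suc b * (f * e ^ c - e ^ c * f - sc ?l * (h * e ^ c'))
        + sc ?l * mon a (Suc (Suc b)) c' \<in> filt n"
      by (rule filt_add)
    moreover have "sc ?l * mon a (Suc (Suc b)) c' = f ^ a * h ^ Suc b * (sc ?l * (h * e ^ c'))"
      by (metis (no_types, opaque_lifting) mon_def mult.assoc power_Suc2 sc_commute)
    ultimately show ?thesis by (simp add: right_diff_distrib)
  qed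
  have "f * ?x - ?x * f - sc ?k * mon (Suc a) b c
      = f ^ a * (f * h ^ Suc b - h ^ Suc b * f - sc ?k * (f * h ^ b)) * e ^ c
      + f ^ a * h ^ Suc b * (f * e ^ c - e ^ c * f)"
  proof -
    have "f ^ a * (sc ?k * (f * h ^ b)) * e ^ c = sc ?k * mon (Suc a) b c"
      by (metis (no_types, opaque_lifting) mon_def mult.assoc power_Suc2 sc_commute)
    moreover have "f * ?x = f ^ a * (f * h ^ Suc b) * e ^ c"
      by (metis (no_types, opaque_lifting) mon_def mult.assoc power_Suc2 power_Suc)
    ultimately show ?thesis
      by (simp only: right_diff_distrib left_diff_distrib) (simp add: mon_def mult.assoc)
  qed
  with filt_add[OF 1 2] have "f * ?x - ?x * f - sc ?k * mon (Suc a) b c \<in> filt n"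
    by simp
  then have "sc ?k * mon (Suc a) b c \<in> filt n"
    by (rule filt_cancel) (use x filt_comm_gen[of f ?x n] in auto)
  then show ?case
    by (rule filt_unscale) simp
qed

text \<open>A generator times an element of \<open>filt d\<close> lies in
  \<open>filt (Suc d)\<close>, and the ordered monomials of degree \<open>Suc d\<close> fall back
  into \<open>filt d\<close> by \<open>top_mon\<close>. So \<open>filt d\<close> is closed under
  left multiplication by generators.\<close>

lemma filt_stable:
  assumes "h ^ Suc d \<in> filt d"
  shows "filt n \<subseteq> filt d"
proof -
  have top: "x \<in> filt d" if "x \<in> filt (Suc d)" for x
  proof -
    from that have "x \<in> pbw (Suc d)" using filt_subset_pbw by blast
    then show ?thesis
    proof (induction rule: pbw.induct)
      case (scale_mon a b c k)
      then show ?case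
        using top_mon[OF assms, of a b c] filt_mon[of a b c d]
        by (intro filt_scale) (auto simp: le_Suc_eq)
    qed (auto intro: filt_intros)
  qed
  show ?thesis
  proof
    fix x assume "x \<in> filt n"
    then show "x \<in> filt d"
      by (induction rule: filt_induct) (auto intro: filt_ideal filt_scalar filt_add top[OF filt_step])
  qed
qed

text \<open>The product of linear factors lies in \<open>I\<close>, hence in \<open>filt d\<close>;
  comparing it with its leading term puts \<open>h ^ Suc d\<close> into \<open>filt d\<close>, as
  \<open>filt_stable\<close> requires.\<close>

lemma pbw_span:
  assumes "foldr (\<lambda>c y. (h + sc c) * y) cs 1 \<in> I" "length cs = Suc d" "x \<in> filt n"
  shows "\<exists>k. x - (\<Sum>(a, b, c)\<in>simplex d. sc (k (a, b, c)) * mon a b c) \<in> I"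
proof -
  let ?p = "foldr (\<lambda>c y. (h + sc c) * y) cs 1"
  have "?p - h ^ Suc d \<in> filt d"
    using filt_prod_linear[of cs] assms(2) by simp
  then have "h ^ Suc d \<in> filt d"
    by (rule filt_cancel) (use assms(1) in \<open>auto intro: filt_ideal\<close>)
  then have "x \<in> pbw d"
    using filt_stable filt_subset_pbw assms(3) by blast
  then show ?thesis by (rule pbw_coeffs)
qed

end

section \<open>The representation on tensor space\<close>

lemma finite_tens_words: "finite (tens_words d)"
  unfolding tens_words_def using finite_lists_length_eq[of "UNIV :: bool set" d] by simp

lemma tens_words_iff: "w \<in> tens_words d \<longleftrightarrow> length w = d"
  by (simp add: tens_words_def)

lemma sum_tens_words_Suc:
  "(\<Sum>w\<in>tens_words (Suc d). g w) = (\<Sum>w\<in>tens_words d. g (True # w) + g (False # w))"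
proof -
  have "tens_words (Suc d) = (#) True ` tens_words d \<union> (#) False ` tens_words d"
    by (auto simp: tens_words_def length_Suc_conv)
  then have "(\<Sum>w\<in>tens_words (Suc d). g w)
      = (\<Sum>w\<in>(#) True ` tens_words d. g w) + (\<Sum>w\<in>(#) False ` tens_words d. g w)"
    by (simp only:) (rule sum.union_disjoint; auto simp: finite_tens_words)
  then show ?thesis
    by (simp add: sum.reindex sum.distrib)
qed

section \<open>Matrices of the differentiated action\<close>

lemma rho_0: "rho 0 x u v = 0"
  by (simp add: rho_def)

text \<open>The Leibniz rule after splitting off the first slot: \<open>x\<close> acts either on the
  head letter or on the tail. Inductions on \<open>d\<close> go through this recursion.\<close>

lemma rho_Suc:
  "rho (Suc d) x (a # u) (b # v)
    = (if u = v \<and> length u = d then x a b else 0) + (if a = b then rho d x u v else 0)"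
proof (cases "length u = d \<and> length v = d")
  case True
  then have "(\<forall>j<d. u ! j = v ! j) \<longleftrightarrow> u = v"
    by (auto simp: list_eq_iff_nth_eq)
  moreover have "(\<forall>j<Suc d. j \<noteq> Suc i \<longrightarrow> (a # u) ! j = (b # v) ! j)
      \<longleftrightarrow> a = b \<and> (\<forall>j<d. j \<noteq> i \<longrightarrow> u ! j = v ! j)" for i
    by (auto simp: less_Suc_eq_0_disj)
  moreover have "(\<forall>j<Suc d. j \<noteq> 0 \<longrightarrow> (a # u) ! j = (b # v) ! j) \<longleftrightarrow> (\<forall>j<d. u ! j = v ! j)"
    by (auto simp: less_Suc_eq_0_disj)
  ultimately show ?thesis
    using True by (simp add: rho_def sum.lessThan_Suc_shift del: sum.lessThan_Suc)
next
  case False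
  then show ?thesis by (auto simp: rho_def)
qed

text \<open>Matrices are functions on all words, so \<open>mat_one d\<close> is a unit only for
  those that vanish unless both words have length \<open>d\<close>.\<close>

definition supported :: "nat \<Rightarrow> (bool list \<Rightarrow> bool list \<Rightarrow> rat) \<Rightarrow> bool" where
  "supported d M \<longleftrightarrow> (\<forall>u v. M u v \<noteq> 0 \<longrightarrow> length u = d \<and> length v = d)"

lemma supported_rho: "supported d (rho d x)"
  by (simp add: supported_def rho_def)

lemma supported_one: "supported d (mat_one d)"
  by (simp add: supported_def mat_one_def)

lemma supported_mult: "supported d M \<Longrightarrow> supported d N \<Longrightarrow> supported d (mat_mult d M N)"
  unfolding supported_def mat_mult_def
  by (metis (no_types, lifting) mult_eq_0_iff sum.neutral)

lemma mat_mult_one_left: "supported d M \<Longrightarrow> mat_mult d (mat_one d) M = M"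
proof (intro ext)
  fix u v assume "supported d M"
  have "mat_mult d (mat_one d) M u v = (\<Sum>w\<in>tens_words d. if u = w then M u v else 0)"
    unfolding mat_mult_def by (rule sum.cong) (auto simp: mat_one_def tens_words_def)
  also have "\<dots> = M u v"
    using \<open>supported d M\<close> by (auto simp: finite_tens_words tens_words_iff supported_def)
  finally show "mat_mult d (mat_one d) M u v = M u v" .
qed

lemma mat_mult_one_right: "supported d M \<Longrightarrow> mat_mult d M (mat_one d) = M"
proof (intro ext)
  fix u v assume "supported d M"
  have "mat_mult d M (mat_one d) u v = (\<Sum>w\<in>tens_words d. if v = w then M u v else 0)"
    unfolding mat_mult_def by (rule sum.cong) (auto simp: mat_one_def tens_words_def)
  also have "\<dots> = M u v"
    using \<open>supported d M\<close> by (auto simp: finite_tens_words tens_words_iff supported_def)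
  finally show "mat_mult d M (mat_one d) u v = M u v" .
qed

lemma mat_mult_assoc: "mat_mult d (mat_mult d L M) N = mat_mult d L (mat_mult d M N)"
  unfolding mat_mult_def sum_distrib_left sum_distrib_right
  by (intro ext, subst sum.swap) (simp add: mult.assoc)

lemma if_mult:
  fixes x y :: rat
  shows "(if P then x else 0) * y = (if P then x * y else 0)"
    and "y * (if P then x else 0) = (if P then y * x else 0)"
  by simp_all

text \<open>Terms with \<open>x\<close> and \<open>y\<close> in different slots agree in the two
  products and cancel. Terms in a common slot leave the matrix commutator there.\<close>

lemma rho_commutator:
  "mat_mult d (rho d x) (rho d y) u v - mat_mult d (rho d y) (rho d x) u v
    = rho d (\<lambda>a b. (\<Sum>c\<in>{True, False}. x a c * y c b - y a c * x c b)) u v"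
proof (induction d arbitrary: u v)
  case 0
  then show ?case by (simp add: mat_mult_def rho_0)
next
  case (Suc d)
  show ?case
  proof (cases "length u = Suc d \<and> length v = Suc d")
    case False
    then have "\<not> (length u = Suc d) \<or> \<not> (length v = Suc d)" by blast
    then show ?thesis by (auto simp: mat_mult_def rho_def)
  next
    case True
    then obtain a u' b v' where uv: "u = a # u'" "v = b # v'" "length u' = d" "length v' = d"
      by (auto simp: length_Suc_conv)
    have rho_uv: "rho (Suc d) x (a # u') (c # w)
        = (if u' = w then x a c else 0) + (if a = c then rho d x u' w else 0)"
      "rho (Suc d) x (c # w) (b # v')
        = (if v' = w then x c b else 0) + (if c = b then rho d x w v' else 0)" for x c w
      using uv by (auto simp: rho_Suc)
    \<comment> \<open>The four summands: both factors act on the head, \<open>x\<close> on the head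
      and \<open>y\<close> on the tail, \<open>x\<close> on the tail and \<open>y\<close> on the
      head, both on the tail.\<close>
    have expand: "(\<Sum>w\<in>tens_words d. rho (Suc d) x (a # u') (c # w) * rho (Suc d) y (c # w) (b # v'))
      = (if u' = v' then x a c * y c b else 0) + (if c = b then x a c * rho d y u' v' else 0)
        + (if a = c then rho d x u' v' * y c b else 0)
        + (if a = c \<and> c = b then mat_mult d (rho d x) (rho d y) u' v' else 0)" for x y c
    proof -
      have "u' \<in> tens_words d" "v' \<in> tens_words d"
        using uv by (simp_all add: tens_words_iff)
      then show ?thesis
        unfolding rho_uv
        by (cases "a = c"; cases "c = b")
          (simp_all add: distrib_left distrib_right sum.distrib mat_mult_def
            if_mult finite_tens_words)
    qed
    have mm: "mat_mult (Suc d) (rho (Suc d) x) (rho (Suc d) y) u v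
      = (\<Sum>c\<in>{True, False}. (if u' = v' then x a c * y c b else 0)
        + (if c = b then x a c * rho d y u' v' else 0)
        + (if a = c then rho d x u' v' * y c b else 0)
        + (if a = c \<and> c = b then mat_mult d (rho d x) (rho d y) u' v' else 0))" for x y
      unfolding mat_mult_def[of "Suc d"] sum_tens_words_Suc uv(1,2) sum.distrib expand by simp
    define br where "br = (\<lambda>a b. \<Sum>c\<in>{True, False}. x a c * y c b - y a c * x c b)"
    have IH: "mat_mult d (rho d x) (rho d y) u' v' = mat_mult d (rho d y) (rho d x) u' v' + rho d br u' v'"
      using Suc.IH[of u' v'] unfolding br_def by (simp only: algebra_simps)
    have br: "br a b = x a True * y True b - y a True * x True b
        + (x a False * y False b - y a False * x False b)"
      by (simp add: br_def)
    have "rho (Suc d) br u v = (if u' = v' then br a b else 0) + (if a = b then rho d br u' v' else 0)"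
      using uv by (simp add: rho_Suc)
    then show ?thesis
      unfolding mm br_def[symmetric] IH br by (cases a; cases b) simp_all
  qed
qed

lemma rho_add: "rho d (\<lambda>a b. x a b + y a b) u v = rho d x u v + rho d y u v"
  by (simp add: rho_def distrib_right sum.distrib)

lemma rho_scale: "rho d (\<lambda>a b. c * x a b) u v = c * rho d x u v"
  by (simp add: rho_def sum_distrib_left mult.assoc)

lemma rho_id: "rho d (\<lambda>a b. if a = b then 1 else 0) u v = of_nat d * mat_one d u v"
proof (induction d arbitrary: u v)
  case (Suc d)
  show ?case
  proof (cases "length u = Suc d \<and> length v = Suc d")
    case True
    then obtain a u' b v' where uv: "u = a # u'" "v = b # v'" "length u' = d" "length v' = d"
      by (auto simp: length_Suc_conv)
    then show ?thesis
      by (simp add: rho_Suc Suc.IH mat_one_def)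
  qed (auto simp: rho_def mat_one_def)
qed (simp add: rho_0)

section \<open>The representation of the free algebra\<close>

fun gmat :: "gen \<Rightarrow> bool \<Rightarrow> bool \<Rightarrow> rat" where
  "gmat GE False True = 1"
| "gmat GF True False = 1"
| "gmat GH False False = 1"
| "gmat GH True True = - 1"
| "gmat _ _ _ = 0"

text \<open>\<open>gl_2\<close> is \<open>sl_2\<close> plus the scalar matrices, and the identity
  acts on tensor space as \<open>d\<close> times the unit by \<open>rho_id\<close>. Hence the images
  of \<open>e\<close>, \<open>f\<close>, \<open>h\<close> generate the whole Schur algebra.\<close>

lemma rho_decompose:
  "rho d x u v = x False True * rho d (gmat GE) u v + x True False * rho d (gmat GF) u v
    + (x False False - x True True) / 2 * rho d (gmat GH) u v
    + (x False False + x True True) / 2 * of_nat d * mat_one d u v"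
proof -
  have "x = (\<lambda>a b. x False True * gmat GE a b + (x True False * gmat GF a b
    + ((x False False - x True True) / 2 * gmat GH a b
    + (x False False + x True True) / 2 * (if a = b then 1 else 0))))"
    by (intro ext, rename_tac a b, case_tac a; case_tac b) (simp_all add: field_simps)
  then have "rho d x u v = rho d (\<lambda>a b. x False True * gmat GE a b + (x True False * gmat GF a b
    + ((x False False - x True True) / 2 * gmat GH a b
    + (x False False + x True True) / 2 * (if a = b then 1 else 0)))) u v"
    by (rule arg_cong)
  then show ?thesis
    unfolding rho_add rho_scale rho_id by (simp add: mult.assoc)
qed

primrec wmat :: "nat \<Rightarrow> gen list \<Rightarrow> bool list \<Rightarrow> bool list \<Rightarrow> rat" where
  "wmat d [] = mat_one d"
| "wmat d (g # w) = mat_mult d (rho d (gmat g)) (wmat d w)"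

lemma supported_wmat: "supported d (wmat d w)"
  by (induction w) (auto intro: supported_one supported_mult supported_rho)

lemma wmat_append: "wmat d (w @ w') = mat_mult d (wmat d w) (wmat d w')"
  by (induction w) (simp_all add: mat_mult_one_left supported_wmat mat_mult_assoc)

definition frep :: "nat \<Rightarrow> (gen list \<Rightarrow> rat) \<Rightarrow> bool list \<Rightarrow> bool list \<Rightarrow> rat" where
  "frep d p = (\<lambda>u v. \<Sum>w | p w \<noteq> 0. p w * wmat d w u v)"

lemma frep_superset:
  "finite S \<Longrightarrow> {w. p w \<noteq> 0} \<subseteq> S \<Longrightarrow> frep d p u v = (\<Sum>w\<in>S. p w * wmat d w u v)"
  unfolding frep_def by (rule sum.mono_neutral_left) auto

lemma supported_frep: "supported d (frep d p)"
  using supported_wmat unfolding supported_def frep_def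
  by (metis (no_types, lifting) mult_eq_0_iff sum.neutral)

lemma frep_add:
  assumes "p \<in> npoly" "q \<in> npoly"
  shows "frep d (nc_add p q) = (\<lambda>u v. frep d p u v + frep d q u v)"
proof (intro ext)
  fix u v
  let ?S = "{w. p w \<noteq> 0} \<union> {w. q w \<noteq> 0}"
  have fin: "finite ?S" using assms by (simp add: npoly_def)
  have sub: "{w. nc_add p q w \<noteq> 0} \<subseteq> ?S" by (auto simp: nc_add_def)
  have "frep d (nc_add p q) u v = (\<Sum>w\<in>?S. nc_add p q w * wmat d w u v)"
    by (rule frep_superset[OF fin sub])
  also have "\<dots> = frep d p u v + frep d q u v"
    using fin by (simp add: frep_superset[of ?S] nc_add_def distrib_right sum.distrib)
  finally show "frep d (nc_add p q) u v = frep d p u v + frep d q u v" .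
qed

lemma frep_smult:
  assumes "p \<in> npoly"
  shows "frep d (nc_smult c p) = (\<lambda>u v. c * frep d p u v)"
proof (intro ext)
  fix u v
  have "frep d (nc_smult c p) u v = (\<Sum>w | p w \<noteq> 0. nc_smult c p w * wmat d w u v)"
    using assms by (intro frep_superset) (auto simp: npoly_def nc_smult_def)
  then show "frep d (nc_smult c p) u v = c * frep d p u v"
    by (simp add: frep_def nc_smult_def sum_distrib_left mult.assoc)
qed

lemma frep_sub:
  assumes "p \<in> npoly" "q \<in> npoly"
  shows "frep d (nc_sub p q) = (\<lambda>u v. frep d p u v - frep d q u v)"
proof -
  have "nc_sub p q = nc_add p (nc_smult (-1) q)"
    by (simp add: nc_sub_def nc_add_def nc_smult_def)
  then show ?thesis
    using assms by (simp add: frep_add frep_smult nc_smult_npoly)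
qed

lemma frep_mult:
  assumes "p \<in> npoly" "q \<in> npoly"
  shows "frep d (nc_mult p q) = mat_mult d (frep d p) (frep d q)"
proof (intro ext)
  fix u v
  let ?A = "{w. p w \<noteq> 0}" and ?B = "{w. q w \<noteq> 0}"
  define W where "W = (\<lambda>(x, y). x @ y) ` (?A \<times> ?B)"
  let ?F = "\<lambda>x y. p x * q y * wmat d (x @ y) u v"
  have fin: "finite ?A" "finite ?B" "finite W" using assms by (auto simp: npoly_def W_def)
  have "frep d (nc_mult p q) u v = (\<Sum>w\<in>W. nc_mult p q w * wmat d w u v)"
    using nc_mult_support[of p q] by (intro frep_superset fin) (simp add: W_def)
  also have "\<dots> = (\<Sum>(w, i)\<in>Sigma W (\<lambda>w. {0..length w}). ?F (take i w) (drop i w))"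
    using fin(3) by (subst sum.Sigma[symmetric]) (auto simp: nc_mult_def sum_distrib_right)
  \<comment> \<open>A word with a cut is the same as a pair of words. Pairs outside
    \<open>?A \<times> ?B\<close> may also concatenate to a word in \<open>W\<close>; they
    contribute 0 and are dropped next.\<close>
  also have "\<dots> = (\<Sum>(x, y)\<in>{(x, y). x @ y \<in> W}. ?F x y)"
    by (rule sum.reindex_bij_witness[of _ "\<lambda>(x, y). (x @ y, length x)" "\<lambda>(w, i). (take i w, drop i w)"])
      auto
  also have "\<dots> = (\<Sum>(x, y)\<in>?A \<times> ?B. ?F x y)"
  proof (rule sum.mono_neutral_right)
    have "{(x, y). x @ y \<in> W} \<subseteq> (\<lambda>(w, i). (take i w, drop i w)) ` Sigma W (\<lambda>w. {0..length w})"
    proof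
      fix t assume "t \<in> {(x, y). x @ y \<in> W}"
      then show "t \<in> (\<lambda>(w, i). (take i w, drop i w)) ` Sigma W (\<lambda>w. {0..length w})"
        by (intro image_eqI[of _ _ "(fst t @ snd t, length (fst t))"]) auto
    qed
    then show "finite {(x, y). x @ y \<in> W}"
      by (rule finite_subset) (use fin(3) in auto)
  qed (auto simp: W_def)
  also have "\<dots> = (\<Sum>x\<in>?A. \<Sum>y\<in>?B. \<Sum>w\<in>tens_words d. (p x * wmat d x u w) * (q y * wmat d y w v))"
    unfolding sum.cartesian_product[symmetric]
    by (intro sum.cong refl) (simp add: wmat_append mat_mult_def sum_distrib_left mult_ac)
  also have "\<dots> = (\<Sum>x\<in>?A. \<Sum>w\<in>tens_words d. \<Sum>y\<in>?B. (p x * wmat d x u w) * (q y * wmat d y w v))"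
    by (intro sum.cong refl sum.swap)
  also have "\<dots> = (\<Sum>w\<in>tens_words d. \<Sum>x\<in>?A. \<Sum>y\<in>?B. (p x * wmat d x u w) * (q y * wmat d y w v))"
    by (rule sum.swap)
  also have "\<dots> = mat_mult d (frep d p) (frep d q) u v"
    by (simp add: mat_mult_def frep_def sum_product)
  finally show "frep d (nc_mult p q) u v = mat_mult d (frep d p) (frep d q) u v" .
qed

lemma frep_var: "frep d (nc_var g) = rho d (gmat g)"
proof -
  have "{w. nc_var g w \<noteq> 0} = {[g]}" by (auto simp: nc_var_def)
  then show ?thesis
    by (simp add: frep_def nc_var_def mat_mult_one_right supported_rho)
qed

lemma frep_const: "frep d (nc_const c) = (\<lambda>u v. c * mat_one d u v)"
proof (intro ext)
  fix u v
  have "frep d (nc_const c) u v = (\<Sum>w\<in>{[]}. nc_const c w * wmat d w u v)"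
    by (rule frep_superset) (auto simp: nc_const_def)
  then show "frep d (nc_const c) u v = c * mat_one d u v" by (simp add: nc_const_def)
qed

lemma frep_zero: "frep d (\<lambda>_. 0) = (\<lambda>u v. 0)"
  by (simp add: frep_def)

lemma free_alg_hom_frep: "free_alg_hom d (frep d)"
  unfolding free_alg_hom_def by (simp add: frep_add frep_smult frep_mult frep_const)

lemma frep_range: "frep d ` npoly = schur_alg d"
proof
  have wmat: "wmat d w \<in> schur_alg d" for w
    by (induction w) (auto intro: schur_alg.intros)
  have zero: "(\<lambda>u v. 0) \<in> schur_alg d"
    using schur_alg.smult[OF schur_alg.one, of 0] by simp
  have "(\<lambda>u v. \<Sum>w\<in>S. p w * wmat d w u v) \<in> schur_alg d" if "finite S" for S p
    using that by induction (simp_all add: zero schur_alg.add schur_alg.smult wmat)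
  then show "frep d ` npoly \<subseteq> schur_alg d"
    by (auto simp: frep_def npoly_def)
  show "schur_alg d \<subseteq> frep d ` npoly"
  proof
    fix M assume "M \<in> schur_alg d"
    then show "M \<in> frep d ` npoly"
    proof induction
      case one
      then show ?case
        by (auto intro!: image_eqI[of _ _ "nc_const 1"] simp: frep_const nc_const_npoly)
    next
      case (gen x)
      \<comment> \<open>The coefficients are those of \<open>rho_decompose\<close>.\<close>
      let ?p = "nc_add (nc_smult (x False True) ncE) (nc_add (nc_smult (x True False) ncF)
        (nc_add (nc_smult ((x False False - x True True) / 2) ncH)
          (nc_const ((x False False + x True True) / 2 * of_nat d))))"
      have "frep d ?p = rho d x"
        by (intro ext, subst rho_decompose)
          (simp add: frep_add frep_smult frep_var frep_const nc_add_npoly nc_smult_npoly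
            nc_var_npoly nc_const_npoly)
      then show ?case
        by (metis image_eqI nc_add_npoly nc_smult_npoly nc_var_npoly nc_const_npoly)
    next
      case (add M N)
      then obtain p q where "p \<in> npoly" "q \<in> npoly" "M = frep d p" "N = frep d q" by auto
      then show ?case
        by (intro image_eqI[of _ _ "nc_add p q"]) (simp_all add: frep_add nc_add_npoly)
    next
      case (smult M c)
      then obtain p where "p \<in> npoly" "M = frep d p" by auto
      then show ?case
        by (intro image_eqI[of _ _ "nc_smult c p"]) (simp_all add: frep_smult nc_smult_npoly)
    next
      case (mult M N)
      then obtain p q where "p \<in> npoly" "q \<in> npoly" "M = frep d p" "N = frep d q" by auto
      then show ?case
        by (intro image_eqI[of _ _ "nc_mult p q"]) (simp_all add: frep_mult nc_mult_npoly)
    qed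
  qed
qed

section \<open>Weights, the eigenvalues of \<open>h\<close>, and vanishing of the relators\<close>

definition weight :: "nat \<Rightarrow> bool list \<Rightarrow> rat" where
  "weight d u = of_nat d - 2 * of_nat (count_list u True)"

lemma rho_GH: "rho d (gmat GH) u v = weight d u * mat_one d u v"
proof (induction d arbitrary: u v)
  case (Suc d)
  show ?case
  proof (cases "length u = Suc d \<and> length v = Suc d")
    case True
    then obtain a u' b v' where uv: "u = a # u'" "v = b # v'" "length u' = d" "length v' = d"
      by (auto simp: length_Suc_conv)
    then show ?thesis
      by (cases a; cases b) (simp_all add: rho_Suc Suc.IH mat_one_def weight_def)
  qed (auto simp: rho_def mat_one_def)
qed (auto simp: rho_0 weight_def mat_one_def)

lemma mat_mult_diag:
  "supported d M \<Longrightarrow> mat_mult d (\<lambda>u v. g u * mat_one d u v) M = (\<lambda>u v. g u * M u v)"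
  using mat_mult_one_left[of d M]
  by (auto simp: fun_eq_iff mat_mult_def mult.assoc simp flip: sum_distrib_left)

lemma nc_prod_list_npoly: "set ps \<subseteq> npoly \<Longrightarrow> nc_prod_list ps \<in> npoly"
  unfolding nc_prod_list_def by (induction ps) (auto simp: nc_const_npoly nc_mult_npoly)

lemma frep_prod_list:
  "frep d (nc_prod_list (map (\<lambda>j. nc_add ncH (nc_const (c j))) js)) u v
    = (\<Prod>j\<leftarrow>js. weight d u + c j) * mat_one d u v"
proof (induction js arbitrary: u v)
  case Nil
  then show ?case by (simp add: nc_prod_list_def frep_const)
next
  case (Cons j js)
  let ?p = "nc_prod_list (map (\<lambda>j. nc_add ncH (nc_const (c j))) js)"
  have "?p \<in> npoly"
    by (auto intro!: nc_prod_list_npoly nc_add_npoly nc_var_npoly nc_const_npoly)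
  then have "frep d (nc_mult (nc_add ncH (nc_const (c j))) ?p)
      = mat_mult d (\<lambda>u v. (weight d u + c j) * mat_one d u v) (frep d ?p)"
    by (simp add: frep_mult frep_add nc_add_npoly nc_var_npoly nc_const_npoly frep_var frep_const
        rho_GH distrib_right)
  also have "\<dots> = (\<lambda>u v. (weight d u + c j) * frep d ?p u v)"
    by (rule mat_mult_diag[OF supported_frep])
  finally show ?case
    using Cons by (simp add: nc_prod_list_def mult.assoc)
qed

lemma schur_relators_npoly: "schur_relators d \<subseteq> npoly"
  unfolding schur_relators_def
  by (auto intro!: nc_sub_npoly nc_add_npoly nc_smult_npoly nc_mult_npoly nc_var_npoly
      nc_const_npoly nc_prod_list_npoly)

lemma pres_ideal_npoly: "p \<in> pres_ideal d \<Longrightarrow> p \<in> npoly"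
  unfolding pres_ideal_def
  by (induction rule: nc_ideal.induct)
    (use schur_relators_npoly in \<open>auto simp: zero_npoly nc_add_npoly nc_mult_npoly\<close>)

lemma frep_relators: "r \<in> schur_relators d \<Longrightarrow> frep d r = (\<lambda>u v. 0)"
proof -
  note npoly = nc_sub_npoly nc_add_npoly nc_smult_npoly nc_mult_npoly nc_var_npoly
  note frep = frep_sub frep_add frep_smult frep_mult frep_var npoly
  have comm: "mat_mult d (rho d (gmat g)) (rho d (gmat g')) u v
      = mat_mult d (rho d (gmat g')) (rho d (gmat g)) u v + c * rho d (gmat k) u v"
    if "\<And>a b. (\<Sum>t\<in>{True, False}. gmat g a t * gmat g' t b - gmat g' a t * gmat g t b) = c * gmat k a b"
    for g g' k c u v
    using rho_commutator[of d "gmat g" "gmat g'" u v] unfolding that rho_scale by simp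
  have he: "mat_mult d (rho d (gmat GH)) (rho d (gmat GE)) u v
      = mat_mult d (rho d (gmat GE)) (rho d (gmat GH)) u v + 2 * rho d (gmat GE) u v" for u v
    by (rule comm, rename_tac a b, case_tac a; case_tac b) simp_all
  have ef: "mat_mult d (rho d (gmat GE)) (rho d (gmat GF)) u v
      = mat_mult d (rho d (gmat GF)) (rho d (gmat GE)) u v + 1 * rho d (gmat GH) u v" for u v
    by (rule comm, rename_tac a b, case_tac a; case_tac b) simp_all
  have hf: "mat_mult d (rho d (gmat GH)) (rho d (gmat GF)) u v
      = mat_mult d (rho d (gmat GF)) (rho d (gmat GH)) u v + (- 2) * rho d (gmat GF) u v" for u v
    by (rule comm, rename_tac a b, case_tac a; case_tac b) simp_all
  have "frep d (nc_prod_list (map (\<lambda>j. nc_add ncH (nc_const (of_int (int d - 2 * int j)))) [0..<d+1])) u v = 0"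
    for u v
  proof (cases "length u = d")
    case True
    \<comment> \<open>With \<open>t\<close> letters \<open>True\<close> the weight is
      \<open>d - 2 * t\<close>, and the factor with index \<open>j = d - t\<close> adds
      \<open>d - 2 * j = 2 * t - d\<close> to it.\<close>
    let ?j = "d - count_list u True"
    have le: "count_list u True \<le> d" using True count_le_length[of u True] by simp
    have "?j \<in> set [0..<d+1]" by auto
    moreover have "weight d u + of_int (int d - 2 * int ?j) = 0"
      using le by (simp add: weight_def of_nat_diff)
    ultimately have "(\<Prod>j\<leftarrow>[0..<d+1]. weight d u + of_int (int d - 2 * int j)) = 0"
      unfolding prod_list_zero_iff by (force simp del: upt_Suc)
    then show ?thesis
      unfolding frep_prod_list by simp
  next
    case False
    then show ?thesis
      unfolding frep_prod_list by (simp add: mat_one_def)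
  qed
  then show "r \<in> schur_relators d \<Longrightarrow> frep d r = (\<lambda>u v. 0)"
    unfolding schur_relators_def
    by (auto simp: frep he ef hf simp del: upt_Suc)
qed

lemma frep_pres_ideal: "p \<in> pres_ideal d \<Longrightarrow> frep d p = (\<lambda>u v. 0)"
proof -
  assume "p \<in> pres_ideal d"
  then have "p \<in> nc_ideal (schur_relators d)" by (simp add: pres_ideal_def)
  then show ?thesis
  proof induction
    case (gen r)
    then show ?case by (rule frep_relators)
  next
    case zero
    then show ?case by (rule frep_zero)
  next
    case (add a b)
    then show ?case
      using pres_ideal_npoly by (simp add: frep_add pres_ideal_def)
  next
    case (mult a x y)
    then show ?case
      using pres_ideal_npoly by (simp add: frep_mult nc_mult_npoly pres_ideal_def mat_mult_def)
  qed
qed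

section \<open>Independence\<close>

text \<open>Inclusion of the sets of positions that carry \<open>e2\<close>, for words of equal
  length. Applying \<open>f\<close> moves upward in this order.\<close>

abbreviation below :: "bool list \<Rightarrow> bool list \<Rightarrow> bool" where
  "below \<equiv> list_all2 (\<longrightarrow>)"

lemma below_count: "below w u \<Longrightarrow> count_list w True \<le> count_list u True"
  by (induction rule: list_all2_induct) auto

lemma below_count_eq: "below w u \<Longrightarrow> count_list w True = count_list u True \<Longrightarrow> w = u"
proof (induction rule: list_all2_induct)
  case (Cons a w b u)
  then show ?case using below_count[of w u] by (cases a; cases b) auto
qed simp

lemma below_trans: "below u v \<Longrightarrow> below v w \<Longrightarrow> below u w"
  by (rule list_all2_trans[of "(\<longrightarrow>)" "(\<longrightarrow>)" "(\<longrightarrow>)"]) auto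

lemma below_refl: "below u u"
  by (rule list_all2_refl) simp

lemma gmat_nonneg_GF: "gmat GF a b \<ge> 0"
  by (cases a; cases b) simp_all

lemma rho_GF_nonneg: "rho d (gmat GF) u v \<ge> 0"
  by (auto simp: rho_def gmat_nonneg_GF intro!: sum_nonneg)

lemma rho_GF_nonzero:
  "rho d (gmat GF) u v \<noteq> 0 \<Longrightarrow> below v u \<and> count_list u True = Suc (count_list v True)"
proof (induction d arbitrary: u v)
  case (Suc d)
  then have "length u = Suc d" "length v = Suc d"
    using supported_rho[of "Suc d" "gmat GF"] by (auto simp: supported_def)
  then obtain a u' b v' where uv: "u = a # u'" "v = b # v'" "length u' = d" "length v' = d"
    by (auto simp: length_Suc_conv)
  then show ?case
    using Suc.prems Suc.IH[of u' v']
    by (cases a; cases b) (auto simp: rho_Suc below_refl split: if_splits)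
qed (simp add: rho_0)

text \<open>Some position has \<open>True\<close> in \<open>u\<close> and \<open>False\<close> in
  \<open>w\<close>; switching it to \<open>False\<close> in \<open>u\<close> gives a predecessor of
  \<open>u\<close> that is still above \<open>w\<close>.\<close>

lemma rho_GF_step:
  "below w u \<Longrightarrow> length u = d \<Longrightarrow> count_list w True < count_list u True \<Longrightarrow>
    \<exists>x. below w x \<and> length x = d \<and> count_list u True = Suc (count_list x True) \<and> rho d (gmat GF) u x > 0"
proof (induction d arbitrary: u w)
  case (Suc d)
  then obtain a u' b w' where uw: "u = a # u'" "w = b # w'" "length u' = d" "below w' u'" "b \<longrightarrow> a"
    by (auto simp: length_Suc_conv list_all2_Cons2)
  show ?case
  proof (cases "a = b")
    case True
    then have "count_list w' True < count_list u' True"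
      using uw Suc.prems by (auto split: if_splits)
    from Suc.IH[OF uw(4,3) this] obtain x where x: "below w' x" "length x = d"
      "count_list u' True = Suc (count_list x True)" "rho d (gmat GF) u' x > 0" by auto
    moreover have "gmat GF a a = 0" by (cases a) simp_all
    ultimately show ?thesis
      using uw True by (intro exI[of _ "a # x"]) (auto simp: rho_Suc)
  next
    case False
    then show ?thesis
      using uw by (intro exI[of _ "False # u'"]) (auto simp: rho_Suc)
  qed
qed simp

lemma wmat_GF_nonneg: "wmat d (replicate n GF) u w \<ge> 0"
proof (induction n arbitrary: u)
  case (Suc n)
  then show ?case
    by (auto simp: mat_mult_def intro!: sum_nonneg mult_nonneg_nonneg rho_GF_nonneg)
qed (simp add: mat_one_def)

lemma wmat_GF_nonzero:
  "wmat d (replicate n GF) u w \<noteq> 0 \<Longrightarrow> below w u \<and> count_list u True = count_list w True + n"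
proof (induction n arbitrary: u)
  case 0
  then show ?case by (auto simp: mat_one_def below_refl split: if_splits)
next
  case (Suc n)
  then have "(\<Sum>x\<in>tens_words d. rho d (gmat GF) u x * wmat d (replicate n GF) x w) \<noteq> 0"
    by (simp add: mat_mult_def)
  then obtain x where "rho d (gmat GF) u x * wmat d (replicate n GF) x w \<noteq> 0"
    by (rule sum.not_neutral_contains_not_neutral)
  then show ?case
    using rho_GF_nonzero[of d u x] Suc.IH[of x] below_trans[of w x u] by auto
qed

text \<open>All entries are nonnegative, so paths cannot cancel and one path from \<open>w\<close>
  up to \<open>u\<close> suffices. \<open>rho_GF_step\<close> supplies its last step.\<close>

lemma wmat_GF_pos:
  "below w u \<Longrightarrow> length u = d \<Longrightarrow> count_list u True = count_list w True + n \<Longrightarrow>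
    wmat d (replicate n GF) u w > 0"
proof (induction n arbitrary: u)
  case 0
  then show ?case using below_count_eq[of w u] by (simp add: mat_one_def)
next
  case (Suc n)
  then obtain x where x: "below w x" "length x = d" "count_list u True = Suc (count_list x True)"
    "rho d (gmat GF) u x > 0"
    using rho_GF_step[of w u d] by auto
  then have "wmat d (replicate n GF) x w > 0"
    using Suc by simp
  then have "0 < rho d (gmat GF) u x * wmat d (replicate n GF) x w"
    using x by simp
  moreover have "x \<in> tens_words d" using x by (simp add: tens_words_iff)
  ultimately show ?case
    unfolding replicate_Suc wmat.simps mat_mult_def
    by (intro sum_pos2[OF finite_tens_words]) (auto intro: mult_nonneg_nonneg rho_GF_nonneg wmat_GF_nonneg)
qed

lemma rho_GE_transpose: "rho d (gmat GE) u v = rho d (gmat GF) v u"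
proof -
  have "gmat GE a b = gmat GF b a" for a b by (cases a; cases b) simp_all
  then show ?thesis unfolding rho_def by (auto intro!: sum.cong)
qed

lemma wmat_GE_transpose: "wmat d (replicate n GE) u v = wmat d (replicate n GF) v u"
proof (induction n arbitrary: u v)
  case (Suc n)
  \<comment> \<open>Transposition reverses products, so the factor that \<open>wmat\<close> splits
    off on the left for \<open>e\<close> must be split off on the right for
    \<open>f\<close>.\<close>
  have "wmat d (replicate (Suc n) GF) = mat_mult d (wmat d (replicate n GF)) (rho d (gmat GF))"
    using wmat_append[of d "replicate n GF" "[GF]"]
    by (simp add: replicate_append_same mat_mult_one_right supported_rho)
  then show ?case
    using Suc by (simp add: mat_mult_def rho_GE_transpose mult.commute)
qed (auto simp: mat_one_def)

lemma wmat_GH: "wmat d (replicate n GH) = (\<lambda>u v. weight d u ^ n * mat_one d u v)"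
proof (induction n)
  case (Suc n)
  have "rho d (gmat GH) = (\<lambda>u v. weight d u * mat_one d u v)"
    by (intro ext) (rule rho_GH)
  then show ?case
    using mat_mult_diag[OF supported_wmat, of d "weight d" "replicate n GH"] Suc
    by (simp add: mult.assoc)
qed simp

lemma frep_pow: "frep d (nc_pow (nc_var g) n) = wmat d (replicate n g)"
  and nc_pow_npoly: "nc_pow (nc_var g) n \<in> npoly"
  by (induction n) (simp_all add: frep_const nc_const_npoly frep_mult nc_var_npoly frep_var nc_mult_npoly)

section \<open>Matrix entries of the ordered monomials\<close>

lemma pbw_mon_npoly: "pbw_mon a b c \<in> npoly"
  by (simp add: pbw_mon_def nc_mult_npoly nc_pow_npoly)

text \<open>Since \<open>h\<close> is diagonal, an entry is a sum over middle words
  \<open>w\<close>, weighted by powers of their eigenvalues. Writing \<open>e\<close> as the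
  transpose of \<open>f\<close> lets both outer factors describe paths going up from
  \<open>w\<close>, so nonzero terms need \<open>w\<close> below both \<open>u\<close> and
  \<open>v\<close>.\<close>

lemma frep_pbw_mon:
  "frep d (pbw_mon a b c) u v
    = (\<Sum>w\<in>tens_words d. wmat d (replicate a GF) u w * weight d w ^ b * wmat d (replicate c GF) v w)"
proof -
  have "frep d (pbw_mon a b c) = mat_mult d (wmat d (replicate a GF))
      (\<lambda>u v. weight d u ^ b * wmat d (replicate c GE) u v)"
    by (simp add: pbw_mon_def frep_mult frep_pow nc_pow_npoly nc_mult_npoly wmat_GH
        mat_mult_diag[OF supported_wmat])
  then show ?thesis
    by (simp add: mat_mult_def wmat_GE_transpose mult.assoc)
qed

section \<open>Recovering the coefficients\<close>

lemma poly_vanishing_coeffs: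
  fixes c :: "nat \<Rightarrow> rat"
  assumes "finite X" "n < card X" "\<And>x. x \<in> X \<Longrightarrow> (\<Sum>i\<le>n. c i * x ^ i) = 0" "i \<le> n"
  shows "c i = 0"
proof (rule ccontr)
  assume "c i \<noteq> 0"
  \<comment> \<open>The coefficients are carried into the reals, where roots are counted;
    \<open>of_rat\<close> is injective, so the points of \<open>X\<close> stay distinct.\<close>
  define C where "C = (\<lambda>i. of_rat (c i) :: real)"
  have "C i \<noteq> 0" using \<open>c i \<noteq> 0\<close> by (simp add: C_def)
  then have fin: "finite {z. (\<Sum>i\<le>n. C i * z ^ i) = 0}"
    and card: "card {z. (\<Sum>i\<le>n. C i * z ^ i) = 0} \<le> n"
    using polyfun_rootbound[of C i n] \<open>i \<le> n\<close> by auto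
  have "of_rat ` X \<subseteq> {z. (\<Sum>i\<le>n. C i * z ^ i) = 0}"
  proof clarify
    fix x assume "x \<in> X"
    have "(\<Sum>i\<le>n. C i * of_rat x ^ i) = (of_rat (\<Sum>i\<le>n. c i * x ^ i) :: real)"
      by (simp add: C_def of_rat_sum of_rat_mult of_rat_power)
    then show "(\<Sum>i\<le>n. C i * of_rat x ^ i) = 0"
      using assms(3)[OF \<open>x \<in> X\<close>] by simp
  qed
  then have "card (of_rat ` X :: real set) \<le> n"
    using card_mono[OF fin] card by (meson order.trans)
  moreover have "card (of_rat ` X :: real set) = card X"
    by (rule card_image) (simp add: inj_on_def)
  ultimately show False
    using assms(2) by simp
qed

text \<open>Write \<open>T\<close>, \<open>F\<close> for the letters \<open>True\<close>, \<open>False\<close>. At \<open>u = T^s T^a F^k F^r\<close> and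
  \<open>v = T^s F^a T^k F^r\<close>, every word pointwise below \<open>u\<close> and \<open>v\<close>
  is below \<open>T^s F^(a+k+r)\<close>. Hence a monomial \<open>f^a' h^b e^k'\<close> of the same weight
  with \<open>a' + k' < a + k\<close> vanishes there, and for \<open>(a', k') = (a, k)\<close> only one path contributes.\<close>

lemma frep_pbw_mon_entry:
  fixes s a k r :: nat
  defines "u \<equiv> replicate s True @ replicate a True @ replicate k False @ replicate r False"
    and "v \<equiv> replicate s True @ replicate a False @ replicate k True @ replicate r False"
  assumes d: "d = s + a + k + r"
  shows "frep d (pbw_mon a' b k') u v \<noteq> 0 \<Longrightarrow> (a', k') = (a, k) \<or> a' + k' > a + k"
    and "\<exists>C. C \<noteq> 0 \<and> (\<forall>b. frep d (pbw_mon a b k) u v = C * (of_nat d - 2 * of_nat s) ^ b)"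
proof -
  \<comment> \<open>\<open>m\<close> is the greatest word below both \<open>u\<close> and
    \<open>v\<close>.\<close>
  define m where "m = replicate s True @ replicate a False @ replicate k False @ replicate r False"
  have cnt_rep: "count_list (replicate n x) y = (if x = y then n else 0)" for n and x y :: bool
    by (induction n) auto
  have cnt: "count_list u True = s + a" "count_list v True = s + k" "count_list m True = s"
    by (simp_all add: u_def v_def m_def cnt_rep)
  have len: "length u = d" "length v = d" "length m = d"
    using d by (simp_all add: u_def v_def m_def)
  have nth: "u ! i \<longleftrightarrow> i < s + a" "v ! i \<longleftrightarrow> i < s \<or> s + a \<le> i \<and> i < s + a + k"
    "m ! i \<longleftrightarrow> i < s" if "i < d" for i
    using that d by (auto simp: u_def v_def m_def nth_append)
  have meet: "below w m" if "below w u" "below w v" for w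
    using that len nth unfolding list_all2_conv_all_nth by (metis not_le)
  have mu: "below m u" and mv: "below m v"
    using len nth unfolding list_all2_conv_all_nth by auto
  have path: "below w m \<and> count_list w True + a' = s + a \<and> count_list w True + k' = s + k"
    if "wmat d (replicate a' GF) u w * x * wmat d (replicate k' GF) v w \<noteq> 0" for w a' k' x
    using that wmat_GF_nonzero[of d a' u w] wmat_GF_nonzero[of d k' v w] meet[of w] cnt by auto
  show "(a', k') = (a, k) \<or> a' + k' > a + k" if nz: "frep d (pbw_mon a' b k') u v \<noteq> 0"
  proof -
    from nz obtain w where
      "wmat d (replicate a' GF) u w * weight d w ^ b * wmat d (replicate k' GF) v w \<noteq> 0"
      unfolding frep_pbw_mon by (rule sum.not_neutral_contains_not_neutral)
    \<comment> \<open>The middle word has \<open>s + a - a' = s + k - k'\<close> letters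
      \<open>True\<close>, and at most \<open>s\<close> because it lies below \<open>m\<close>. So
      \<open>a' - a = k' - k\<close> is nonnegative.\<close>
    from path[OF this] below_count[of w m] cnt show ?thesis by auto
  qed
  let ?C = "wmat d (replicate a GF) u m * wmat d (replicate k GF) v m"
  have "frep d (pbw_mon a b k) u v = ?C * (of_nat d - 2 * of_nat s) ^ b" for b
  proof -
    have "frep d (pbw_mon a b k) u v = (\<Sum>w\<in>{m}.
        wmat d (replicate a GF) u w * weight d w ^ b * wmat d (replicate k GF) v w)"
      unfolding frep_pbw_mon
    proof (rule sum.mono_neutral_right)
      show "\<forall>w\<in>tens_words d - {m}.
          wmat d (replicate a GF) u w * weight d w ^ b * wmat d (replicate k GF) v w = 0"
        using path[of a _ _ k] below_count_eq[of _ m] cnt by fastforce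
    qed (use len in \<open>auto simp: finite_tens_words tens_words_iff\<close>)
    then show ?thesis
      using cnt by (simp add: weight_def)
  qed
  moreover have "?C \<noteq> 0"
    using wmat_GF_pos[OF mu len(1), of a] wmat_GF_pos[OF mv len(2), of k] cnt by simp
  ultimately show "\<exists>C. C \<noteq> 0 \<and> (\<forall>b. frep d (pbw_mon a b k) u v = C * (of_nat d - 2 * of_nat s) ^ b)"
    by blast
qed

text \<open>Induction in descending order of \<open>a + k\<close>. At the chosen \<open>u\<close>
  and \<open>v\<close>, pairs with larger sum drop out by the induction hypothesis and the other
  pairs \<open>(a', k') \<noteq> (a, k)\<close> because their entries vanish. The factor
  \<open>C\<close> may depend on \<open>s\<close> but not on \<open>b\<close>, so it divides out and
  leaves a polynomial evaluated at \<open>d - 2 * s\<close>.\<close>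

lemma frep_pbw_independent:
  assumes zero: "\<And>u v. (\<Sum>(a, b, k)\<in>simplex d. c (a, b, k) * frep d (pbw_mon a b k) u v) = 0"
  shows "a + b + k \<le> d \<Longrightarrow> c (a, b, k) = 0"
proof (induction "d - (a + k)" arbitrary: a b k rule: less_induct)
  case less
  let ?n = "d - (a + k)"
  have "(\<Sum>b\<le>?n. c (a, b, k) * x ^ b) = 0" if x: "x \<in> (\<lambda>s. of_nat d - 2 * of_nat s) ` {..?n}" for x
  proof -
    from x obtain s where s: "s \<le> ?n" "x = of_nat d - 2 * of_nat s" by auto
    define r where "r = ?n - s"
    have d: "d = s + a + k + r" using s less.prems by (simp add: r_def)
    define u where "u = replicate s True @ replicate a True @ replicate k False @ replicate r False"
    define v where "v = replicate s True @ replicate a False @ replicate k True @ replicate r False"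
    note entry = frep_pbw_mon_entry[OF d, folded u_def v_def]
    obtain C where C: "C \<noteq> 0" "\<And>b. frep d (pbw_mon a b k) u v = C * x ^ b"
      using entry(2) s by blast
    have "0 = (\<Sum>(a', b, k')\<in>simplex d. c (a', b, k') * frep d (pbw_mon a' b k') u v)"
      using zero by simp
    also have "\<dots> = (\<Sum>(a', b, k')\<in>(\<lambda>b. (a, b, k)) ` {..?n}.
        c (a', b, k') * frep d (pbw_mon a' b k') u v)"
    proof (rule sum.mono_neutral_right[OF finite_simplex])
      show "(\<lambda>b. (a, b, k)) ` {..?n} \<subseteq> simplex d"
        using less.prems by auto
      have "c (a', b', k') * frep d (pbw_mon a' b' k') u v = 0"
        if t: "a' + b' + k' \<le> d" "(a', b', k') \<notin> (\<lambda>b. (a, b, k)) ` {..?n}" for a' b' k'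
      proof (rule ccontr)
        assume nz: "c (a', b', k') * frep d (pbw_mon a' b' k') u v \<noteq> 0"
        then have "(a', k') = (a, k) \<or> a' + k' > a + k"
          using entry(1)[of a' b' k'] by auto
        moreover have "(a', k') \<noteq> (a, k)" using t by auto
        ultimately have "a' + k' > a + k" by blast
        then have "c (a', b', k') = 0"
          using t by (intro less.hyps) auto
        then show False using nz by simp
      qed
      then show "\<forall>t\<in>simplex d - (\<lambda>b. (a, b, k)) ` {..?n}.
          (case t of (a', b, k') \<Rightarrow> c (a', b, k') * frep d (pbw_mon a' b k') u v) = 0"
        unfolding Ball_def split_paired_All by (simp del: mult_eq_0_iff)
    qed
    also have "\<dots> = (\<Sum>b\<le>?n. c (a, b, k) * (C * x ^ b))"
      by (subst sum.reindex) (auto simp: inj_on_def C)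
    also have "\<dots> = C * (\<Sum>b\<le>?n. c (a, b, k) * x ^ b)"
      by (simp add: sum_distrib_left mult_ac)
    finally show ?thesis using C by simp
  qed
  moreover have "card ((\<lambda>s. of_nat d - 2 * of_nat s :: rat) ` {..?n}) = Suc ?n"
    by (subst card_image) (auto simp: inj_on_def)
  ultimately show ?case
    using less.prems
    by (intro poly_vanishing_coeffs[where c = "\<lambda>b. c (a, b, k)" and n = ?n
          and X = "(\<lambda>s. of_nat d - 2 * of_nat s) ` {..?n}"])
      (simp_all del: mult_eq_0_iff)
qed

section \<open>The presentation\<close>

lemma nc_mult_indicator:
  "nc_mult (nc_var g) (\<lambda>v. if v = w then 1 else 0) = (\<lambda>v. if v = g # w then 1 else 0)"
proof
  fix v
  show "nc_mult (nc_var g) (\<lambda>v. if v = w then 1 else 0) v = (if v = g # w then 1 else 0)"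
  proof (cases v)
    case (Cons g' v')
    have "nc_mult (nc_var g) (\<lambda>v. if v = w then 1 else 0) v
        = (\<Sum>i\<in>{0..length v}. if i = 1 then if v = g # w then 1 else 0 else 0)"
      unfolding nc_mult_def
    proof (rule sum.cong)
      fix i
      show "nc_var g (take i v) * (if drop i v = w then 1 else 0)
          = (if i = 1 then if v = g # w then 1 else 0 else 0)" if "i \<in> {0..length v}"
        using that Cons by (cases i) (auto simp: nc_var_def)
    qed simp
    then show ?thesis using Cons by (auto simp: Suc_le_eq)
  qed (simp add: nc_mult_def nc_var_def)
qed

lemma Rep_fralg_word: "Rep_fralg (prod_list (map fvar w)) = (\<lambda>v. if v = w then 1 else 0)"
proof (induction w)
  case Nil
  then show ?case by (auto simp: one_fralg.rep_eq nc_const_def)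
next
  case (Cons g w)
  then show ?case by (simp add: times_fralg.rep_eq fvar.rep_eq nc_mult_indicator)
qed

lemma Rep_fralg_sum: "Rep_fralg (sum x S) = (\<lambda>w. \<Sum>i\<in>S. Rep_fralg (x i) w)"
  by (induction S rule: infinite_finite_induct)
    (simp_all add: zero_fralg.rep_eq plus_fralg.rep_eq nc_add_def)

lemma Rep_fralg_power: "Rep_fralg (x ^ n) = nc_pow (Rep_fralg x) n"
  by (induction n) (simp_all add: one_fralg.rep_eq times_fralg.rep_eq)

lemma fralg_expand:
  "x = (\<Sum>w | Rep_fralg x w \<noteq> 0. fconst (Rep_fralg x w) * prod_list (map fvar w))"
proof (rule Rep_fralg_inject[THEN iffD1], rule ext)
  fix v
  have fin: "finite {w. Rep_fralg x w \<noteq> 0}"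
    using Rep_fralg[of x] by (simp add: npoly_def)
  have "(\<Sum>w | Rep_fralg x w \<noteq> 0. nc_smult (Rep_fralg x w) (\<lambda>v. if v = w then 1 else 0) v)
      = (\<Sum>w | Rep_fralg x w \<noteq> 0. if v = w then Rep_fralg x v else 0)"
    by (rule sum.cong) (auto simp: nc_smult_def)
  also have "\<dots> = Rep_fralg x v"
    using fin by simp
  finally show "Rep_fralg x v =
      Rep_fralg (\<Sum>w | Rep_fralg x w \<noteq> 0. fconst (Rep_fralg x w) * prod_list (map fvar w)) v"
    by (simp add: Rep_fralg_sum fconst_scale Rep_fralg_word)
qed

definition fideal :: "nat \<Rightarrow> fralg set" where
  "fideal d = {x. Rep_fralg x \<in> pres_ideal d}"

lemma pres_ideal_mult_left: "p \<in> pres_ideal d \<Longrightarrow> q \<in> npoly \<Longrightarrow> nc_mult q p \<in> pres_ideal d"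
  using nc_ideal.mult[of p "schur_relators d" q "nc_const 1"]
  by (simp add: pres_ideal_def nc_const_npoly nc_mult_const_right nc_smult_def)

lemma pres_ideal_mult_right: "p \<in> pres_ideal d \<Longrightarrow> q \<in> npoly \<Longrightarrow> nc_mult p q \<in> pres_ideal d"
  using nc_ideal.mult[of p "schur_relators d" "nc_const 1" q]
  by (simp add: pres_ideal_def nc_const_npoly nc_mult_const_left nc_smult_def)

interpretation fralg: sl2_ideal "fideal d" fconst "fvar GE" "fvar GF" "fvar GH" for d
proof
  fix a b :: rat and x y :: fralg
  note rep = zero_fralg.rep_eq plus_fralg.rep_eq minus_fralg.rep_eq times_fralg.rep_eq
    fvar.rep_eq fconst.rep_eq nc_mult_const_left
  show "fconst (a + b) = fconst a + fconst b" by (rule fconst_add)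
  show "fconst (a * b) = fconst a * fconst b" by (rule fconst_mult)
  show "fconst 1 = 1" by (rule fconst_1)
  show "fconst a * x = x * fconst a" by (rule fconst_commute)
  show "0 \<in> fideal d"
    by (simp add: fideal_def rep pres_ideal_def nc_ideal.zero)
  show "x \<in> fideal d \<Longrightarrow> y \<in> fideal d \<Longrightarrow> x + y \<in> fideal d"
    by (simp add: fideal_def rep pres_ideal_def nc_ideal.add)
  show "x \<in> fideal d \<Longrightarrow> y * x \<in> fideal d"
    by (simp add: fideal_def rep pres_ideal_mult_left Rep_fralg)
  show "x \<in> fideal d \<Longrightarrow> x * y \<in> fideal d"
    by (simp add: fideal_def rep pres_ideal_mult_right Rep_fralg)
  show "fvar GH * fvar GE - fvar GE * fvar GH - fconst 2 * fvar GE \<in> fideal d"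
    "fvar GE * fvar GF - fvar GF * fvar GE - fvar GH \<in> fideal d"
    "fvar GH * fvar GF - fvar GF * fvar GH + fconst 2 * fvar GF \<in> fideal d"
    unfolding fideal_def mem_Collect_eq rep pres_ideal_def
    by (auto intro!: nc_ideal.gen simp: schur_relators_def simp del: upt_Suc)
qed

lemma Rep_fralg_mon: "Rep_fralg (fralg.mon a b c) = pbw_mon a b c"
  by (simp add: fralg.mon_def pbw_mon_def times_fralg.rep_eq Rep_fralg_power fvar.rep_eq nc_mult_assoc)

text \<open>An element has finitely many words, and the sum of their lengths bounds each length.
  This crude common degree suffices because \<open>pbw_span\<close> accepts any
  \<open>n\<close>.\<close>

lemma fralg_filt: "\<exists>n. x \<in> fralg.filt d n"
proof -
  let ?S = "{w. Rep_fralg x w \<noteq> 0}"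
  have fin: "finite ?S"
    using Rep_fralg[of x] by (simp add: npoly_def)
  have words: "prod_list (map fvar w) \<in> fralg.filt d (length w)" for w
  proof (induction w)
    case Nil
    then show ?case by (simp add: fralg.filt_1)
  next
    case (Cons g w)
    then show ?case using fralg.filt_step[OF Cons, of "fvar g"] by (cases g) simp_all
  qed
  have "fconst (Rep_fralg x w) * prod_list (map fvar w) \<in> fralg.filt d (\<Sum>w\<in>?S. length w)"
    if "w \<in> ?S" for w
  proof -
    have "length w \<le> (\<Sum>w\<in>?S. length w)"
      using fin that by (intro member_le_sum) auto
    with words show ?thesis
      by (rule fralg.filt_scale[OF fralg.filt_mono])
  qed
  then have "(\<Sum>w\<in>?S. fconst (Rep_fralg x w) * prod_list (map fvar w)) \<in> fralg.filt d (\<Sum>w\<in>?S. length w)"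
    by (rule fralg.filt_sum[where x = "\<lambda>w. fconst (Rep_fralg x w) * prod_list (map fvar w)"])
  then show ?thesis
    using fralg_expand[of x] by metis
qed

section \<open>Kernel and basis\<close>

definition pbw_comb :: "nat \<Rightarrow> (nat \<times> nat \<times> nat \<Rightarrow> rat) \<Rightarrow> gen list \<Rightarrow> rat" where
  "pbw_comb d c = (\<lambda>w. \<Sum>(a, b, k)\<in>simplex d. c (a, b, k) * pbw_mon a b k w)"

lemma pbw_comb_spans:
  assumes "p \<in> npoly"
  shows "\<exists>c. nc_sub p (pbw_comb d c) \<in> pres_ideal d"
proof -
  define x where "x = Abs_fralg p"
  have x: "Rep_fralg x = p" using assms by (simp add: x_def Abs_fralg_inverse)
  let ?cs = "map (\<lambda>j. of_int (int d - 2 * int j)) [0..<d+1] :: rat list"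
  obtain n where n: "x \<in> fralg.filt d n" using fralg_filt by blast
  \<comment> \<open>\<open>pbw_span\<close> folds ring products while the relator folds
    \<open>nc_mult\<close>; the two forms match under \<open>Rep_fralg\<close>.\<close>
  have "Rep_fralg (foldr (\<lambda>c y. (fvar GH + fconst c) * y) cs 1)
      = nc_prod_list (map (\<lambda>c. nc_add ncH (nc_const c)) cs)" for cs
    by (induction cs)
      (simp_all add: nc_prod_list_def one_fralg.rep_eq times_fralg.rep_eq plus_fralg.rep_eq
        fvar.rep_eq fconst.rep_eq)
  from this[of ?cs] have "foldr (\<lambda>c y. (fvar GH + fconst c) * y) ?cs 1 \<in> fideal d"
    unfolding fideal_def mem_Collect_eq pres_ideal_def
    by (simp only: map_map comp_def) (rule nc_ideal.gen, simp add: schur_relators_def del: upt_Suc)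
  from fralg.pbw_span[OF this _ n] obtain c where
    "x - (\<Sum>(a, b, k)\<in>simplex d. fconst (c (a, b, k)) * fralg.mon a b k) \<in> fideal d"
    by auto
  then show ?thesis
    unfolding fideal_def pbw_comb_def
    by (auto simp: minus_fralg.rep_eq x Rep_fralg_sum fconst_scale Rep_fralg_mon nc_smult_def
        case_prod_beta)
qed

lemma frep_sum:
  assumes "\<And>i. i \<in> S \<Longrightarrow> q i \<in> npoly"
  shows "(\<lambda>w. \<Sum>i\<in>S. c i * q i w) \<in> npoly
    \<and> frep d (\<lambda>w. \<Sum>i\<in>S. c i * q i w) = (\<lambda>u v. \<Sum>i\<in>S. c i * frep d (q i) u v)"
  using assms
proof (induction S rule: infinite_finite_induct)
  case (insert i S)
  let ?p = "\<lambda>w. \<Sum>i\<in>S. c i * q i w"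
  have "(\<lambda>w. \<Sum>i\<in>insert i S. c i * q i w) = nc_add (nc_smult (c i) (q i)) ?p"
    using insert by (simp add: nc_add_def nc_smult_def)
  then show ?case
    using insert by (simp add: nc_add_npoly nc_smult_npoly frep_add frep_smult)
qed (simp_all add: zero_npoly frep_zero)

lemma frep_pbw_comb:
  "pbw_comb d c \<in> npoly"
  "frep d (pbw_comb d c) u v = (\<Sum>(a, b, k)\<in>simplex d. c (a, b, k) * frep d (pbw_mon a b k) u v)"
  using frep_sum[of "simplex d" "\<lambda>(a, b, k). pbw_mon a b k" c d]
  by (auto simp: pbw_comb_def pbw_mon_npoly case_prod_beta)

text \<open>An element of the kernel differs from some \<open>pbw_comb d c\<close> by an element of
  the ideal, which \<open>frep\<close> kills. So \<open>pbw_comb d c\<close> is in the kernel too,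
  independence on tensor space makes \<open>c\<close> vanish on the simplex, and the element itself
  lies in the ideal.\<close>

lemma frep_kernel: "{p \<in> npoly. frep d p = (\<lambda>u v. 0)} = pres_ideal d"
proof (intro subset_antisym subsetI)
  fix p assume "p \<in> {p \<in> npoly. frep d p = (\<lambda>u v. 0)}"
  then have p: "p \<in> npoly" "frep d p = (\<lambda>u v. 0)" by auto
  obtain c where c: "nc_sub p (pbw_comb d c) \<in> pres_ideal d"
    using pbw_comb_spans[OF p(1)] by blast
  have "frep d (pbw_comb d c) u v = 0" for u v
    using frep_pres_ideal[OF c] p by (simp add: frep_sub frep_pbw_comb(1) fun_eq_iff)
  then have "c (a, b, k) = 0" if "a + b + k \<le> d" for a b k
    using that unfolding frep_pbw_comb(2) by (rule frep_pbw_independent)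
  then have "pbw_comb d c = (\<lambda>_. 0)"
    unfolding pbw_comb_def by (intro ext sum.neutral) auto
  with c show "p \<in> pres_ideal d" by (simp add: nc_sub_def)
qed (simp add: pres_ideal_npoly frep_pres_ideal)

theorem theorem2p1:
  fixes d :: nat
  shows "(\<exists>\<phi>. free_alg_hom d \<phi> \<and> \<phi> ` npoly = schur_alg d \<and>
              {p \<in> npoly. \<phi> p = (\<lambda>u v. 0)} = pres_ideal d)
    \<and> (\<forall>x\<in>npoly. \<exists>c :: nat \<times> nat \<times> nat \<Rightarrow> rat.
          nc_sub x (\<lambda>w. \<Sum>(a, b, k)\<in>{(a, b, k). a + b + k \<le> d}. c (a, b, k) * pbw_mon a b k w)
            \<in> pres_ideal d)
    \<and> (\<forall>c :: nat \<times> nat \<times> nat \<Rightarrow> rat.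
          (\<lambda>w. \<Sum>(a, b, k)\<in>{(a, b, k). a + b + k \<le> d}. c (a, b, k) * pbw_mon a b k w) \<in> pres_ideal d
          \<longrightarrow> (\<forall>a b k. a + b + k \<le> d \<longrightarrow> c (a, b, k) = 0))"
proof (intro conjI)
  show "\<exists>\<phi>. free_alg_hom d \<phi> \<and> \<phi> ` npoly = schur_alg d \<and>
      {p \<in> npoly. \<phi> p = (\<lambda>u v. 0)} = pres_ideal d"
    using free_alg_hom_frep frep_range frep_kernel by blast
  show "\<forall>x\<in>npoly. \<exists>c :: nat \<times> nat \<times> nat \<Rightarrow> rat.
      nc_sub x (\<lambda>w. \<Sum>(a, b, k)\<in>{(a, b, k). a + b + k \<le> d}. c (a, b, k) * pbw_mon a b k w)
        \<in> pres_ideal d"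
    using pbw_comb_spans unfolding pbw_comb_def by blast
  show "\<forall>c :: nat \<times> nat \<times> nat \<Rightarrow> rat.
      (\<lambda>w. \<Sum>(a, b, k)\<in>{(a, b, k). a + b + k \<le> d}. c (a, b, k) * pbw_mon a b k w) \<in> pres_ideal d
      \<longrightarrow> (\<forall>a b k. a + b + k \<le> d \<longrightarrow> c (a, b, k) = 0)"
  proof (intro allI impI)
    fix c :: "nat \<times> nat \<times> nat \<Rightarrow> rat" and a b k
    assume "(\<lambda>w. \<Sum>(a, b, k)\<in>{(a, b, k). a + b + k \<le> d}. c (a, b, k) * pbw_mon a b k w)
      \<in> pres_ideal d" and abk: "a + b + k \<le> d"
    \<comment> \<open>\<open>frep\<close> kills the ideal, so independence of the images on tensor
      space passes to the presented algebra.\<close>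
    then have "frep d (pbw_comb d c) = (\<lambda>u v. 0)"
      by (intro frep_pres_ideal) (simp add: pbw_comb_def)
    then have "(\<Sum>(a, b, k)\<in>simplex d. c (a, b, k) * frep d (pbw_mon a b k) u v) = 0" for u v
      unfolding frep_pbw_comb(2)[symmetric] by simp
    then show "c (a, b, k) = 0"
      using abk by (rule frep_pbw_independent)
  qed
qed

end
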